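(* (Phragmen–Lindelöf alternative.) Let $\Omega\subset\mathbb{R}^N$, $N\ge2$, be a bounded smooth domain, $\delta(x)=\mathrm{dist}(x,\partial\Omega)$, and let $\mu\le1/4$. Let $\underline h$ be a local sub-harmonic of $\mathscr{L}_\mu=-\Delta-\mu/\delta^2$. Then the following alternative holds: (i) either for every local super-harmonic $\overline h>0$ of $\mathscr{L}_\mu$ one has $\limsup_{x\to\partial\Omega}\underline h/\overline h>0$; (ii) or for every local super-harmonic $\overline h>0$ of $\mathscr{L}_\mu$ one has $\limsup_{x\to\partial\Omega}\underline h/\overline h<\infty$.
   Context: Notation: $\Omega_\rho=\{x\in\Omega:\delta(x)<\rho\}$; $H^1_c(G)$ is the space of functions in $H^1(G)$ with compact support in $G$. A sub-harmonic (super-harmonic) of $\mathscr{L}_\mu$ in an open set $G\subset\Omega$ is $h\in H^1_{loc}(G)\cap C(G)$ with $\int_G\nabla h\cdot\nabla\varphi\,dx-\int_G\frac{\mu}{\delta^2}h\varphi\,dx\le 0$ ($\ge0$) for all $0\le\varphi\in H^1_c(G)$. It is called local if $G=\Omega_\rho$ for some $\rho>0$ (which may depend on the function). Limits $x\to\partial\Omega$ mean $\delta(x)\to0$. *)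

theory Defs
  imports "HOL-Analysis.Analysis"
begin

section \<open>Smooth functions and smooth domains\<close>

primrec Ck :: "nat \<Rightarrow> ('a::euclidean_space \<Rightarrow> real) \<Rightarrow> bool" where
  "Ck 0 f \<longleftrightarrow> continuous_on UNIV f"
| "Ck (Suc k) f \<longleftrightarrow>
     f differentiable_on UNIV \<and> (\<forall>v. Ck k (\<lambda>x. frechet_derivative f (at x) v))"

definition smooth :: "('a::euclidean_space \<Rightarrow> real) \<Rightarrow> bool" where
  "smooth f \<longleftrightarrow> (\<forall>k. Ck k f)"

text \<open>
  The boundary is locally the graph of a smooth function over a hyperplane, with the set lying on
  one side of it. The unit vector e is the direction of the last coordinate axis after a rotation,
  and \<gamma> is only ever evaluated on the hyperplane orthogonal to e.
\<close>
definition smooth_boundary :: "'a::euclidean_space set \<Rightarrow> bool" where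
  "smooth_boundary \<Omega> \<longleftrightarrow>
     (\<forall>p\<in>frontier \<Omega>. \<exists>r>0. \<exists>e \<gamma>. norm e = 1 \<and> smooth \<gamma> \<and>
        \<Omega> \<inter> ball p r = {x \<in> ball p r. x \<bullet> e > \<gamma> (x - (x \<bullet> e) *\<^sub>R e)})"

definition bounded_smooth_domain :: "'a::euclidean_space set \<Rightarrow> bool" where
  "bounded_smooth_domain \<Omega> \<longleftrightarrow>
     open \<Omega> \<and> connected \<Omega> \<and> \<Omega> \<noteq> {} \<and> bounded \<Omega> \<and> smooth_boundary \<Omega>"

section \<open>Sobolev spaces\<close>

definition test_function :: "'a::euclidean_space set \<Rightarrow> ('a \<Rightarrow> real) \<Rightarrow> bool" where
  "test_function G \<phi> \<longleftrightarrow>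
     smooth \<phi> \<and> compact (closure {x. \<phi> x \<noteq> 0}) \<and> closure {x. \<phi> x \<noteq> 0} \<subseteq> G"

definition locally_integrable ::
    "'a::euclidean_space set \<Rightarrow> ('a \<Rightarrow> 'b::euclidean_space) \<Rightarrow> bool" where
  "locally_integrable G f \<longleftrightarrow> (\<forall>K. compact K \<longrightarrow> K \<subseteq> G \<longrightarrow> integrable (lebesgue_on K) f)"

definition L2 :: "'a::euclidean_space set \<Rightarrow> ('a \<Rightarrow> 'b::euclidean_space) \<Rightarrow> bool" where
  "L2 S f \<longleftrightarrow>
     f \<in> borel_measurable (lebesgue_on S) \<and> integrable (lebesgue_on S) (\<lambda>x. (norm (f x))\<^sup>2)"

definition L2_loc :: "'a::euclidean_space set \<Rightarrow> ('a \<Rightarrow> 'b::euclidean_space) \<Rightarrow> bool" where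
  "L2_loc G f \<longleftrightarrow> (\<forall>K. compact K \<longrightarrow> K \<subseteq> G \<longrightarrow> L2 K f)"

text \<open>
  A weak gradient is only determined up to a null set, so it is a relation rather than a function.
\<close>
definition has_weak_gradient ::
    "'a::euclidean_space set \<Rightarrow> ('a \<Rightarrow> real) \<Rightarrow> ('a \<Rightarrow> 'a) \<Rightarrow> bool" where
  "has_weak_gradient G u g \<longleftrightarrow>
     locally_integrable G u \<and> locally_integrable G g \<and>
     (\<forall>\<phi>. test_function G \<phi> \<longrightarrow> (\<forall>b\<in>Basis.
        (LINT x|lebesgue_on G. u x * frechet_derivative \<phi> (at x) b)
          = - (LINT x|lebesgue_on G. (g x \<bullet> b) * \<phi> x)))"

text \<open>
  Membership of u in \<open>H\<^sup>1(G)\<close> and in its local version, with g the weak gradient of u.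
\<close>
definition H1 :: "'a::euclidean_space set \<Rightarrow> ('a \<Rightarrow> real) \<Rightarrow> ('a \<Rightarrow> 'a) \<Rightarrow> bool" where
  "H1 G u g \<longleftrightarrow> has_weak_gradient G u g \<and> L2 G u \<and> L2 G g"

definition H1_loc :: "'a::euclidean_space set \<Rightarrow> ('a \<Rightarrow> real) \<Rightarrow> ('a \<Rightarrow> 'a) \<Rightarrow> bool" where
  "H1_loc G u g \<longleftrightarrow> has_weak_gradient G u g \<and> L2_loc G u \<and> L2_loc G g"

text \<open>
  Elements of \<open>H\<^sup>1(G)\<close> are classes modulo null sets, so the support condition is almost everywhere.
\<close>
definition H1_c :: "'a::euclidean_space set \<Rightarrow> ('a \<Rightarrow> real) \<Rightarrow> ('a \<Rightarrow> 'a) \<Rightarrow> bool" where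
  "H1_c G u g \<longleftrightarrow>
     H1 G u g \<and> (\<exists>K. compact K \<and> K \<subseteq> G \<and> (AE x in lebesgue_on G. x \<notin> K \<longrightarrow> u x = 0))"

section \<open>The Hardy operator near the boundary\<close>

definition bdist :: "'a::euclidean_space set \<Rightarrow> 'a \<Rightarrow> real" where
  "bdist \<Omega> x = infdist x (frontier \<Omega>)"

definition strip :: "'a::euclidean_space set \<Rightarrow> real \<Rightarrow> 'a set" where
  "strip \<Omega> \<rho> = {x \<in> \<Omega>. bdist \<Omega> x < \<rho>}"

definition weak_form ::
    "real \<Rightarrow> 'a::euclidean_space set \<Rightarrow> 'a set \<Rightarrow>
     ('a \<Rightarrow> real) \<Rightarrow> ('a \<Rightarrow> 'a) \<Rightarrow> ('a \<Rightarrow> real) \<Rightarrow> ('a \<Rightarrow> 'a) \<Rightarrow> real" where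
  "weak_form \<mu> \<Omega> G h Dh \<phi> D\<phi> =
     (LINT x|lebesgue_on G. Dh x \<bullet> D\<phi> x)
       - (LINT x|lebesgue_on G. \<mu> / (bdist \<Omega> x)\<^sup>2 * h x * \<phi> x)"

definition subharmonic ::
    "real \<Rightarrow> 'a::euclidean_space set \<Rightarrow> 'a set \<Rightarrow> ('a \<Rightarrow> real) \<Rightarrow> bool" where
  "subharmonic \<mu> \<Omega> G h \<longleftrightarrow>
     continuous_on G h \<and>
     (\<exists>Dh. H1_loc G h Dh \<and>
        (\<forall>\<phi> D\<phi>. H1_c G \<phi> D\<phi> \<longrightarrow> (AE x in lebesgue_on G. 0 \<le> \<phi> x) \<longrightarrow>
           weak_form \<mu> \<Omega> G h Dh \<phi> D\<phi> \<le> 0))"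

definition superharmonic ::
    "real \<Rightarrow> 'a::euclidean_space set \<Rightarrow> 'a set \<Rightarrow> ('a \<Rightarrow> real) \<Rightarrow> bool" where
  "superharmonic \<mu> \<Omega> G h \<longleftrightarrow>
     continuous_on G h \<and>
     (\<exists>Dh. H1_loc G h Dh \<and>
        (\<forall>\<phi> D\<phi>. H1_c G \<phi> D\<phi> \<longrightarrow> (AE x in lebesgue_on G. 0 \<le> \<phi> x) \<longrightarrow>
           weak_form \<mu> \<Omega> G h Dh \<phi> D\<phi> \<ge> 0))"

text \<open>
  Local sub- and super-harmonics are total functions in HOL; their values outside the strip on
  which they satisfy the inequality are irrelevant, and positivity is required on that strip only.
\<close>
definition local_subharmonic ::
    "real \<Rightarrow> 'a::euclidean_space set \<Rightarrow> ('a \<Rightarrow> real) \<Rightarrow> bool" where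
  "local_subharmonic \<mu> \<Omega> h \<longleftrightarrow> (\<exists>\<rho>>0. subharmonic \<mu> \<Omega> (strip \<Omega> \<rho>) h)"

definition pos_local_superharmonic ::
    "real \<Rightarrow> 'a::euclidean_space set \<Rightarrow> ('a \<Rightarrow> real) \<Rightarrow> bool" where
  "pos_local_superharmonic \<mu> \<Omega> h \<longleftrightarrow>
     (\<exists>\<rho>>0. superharmonic \<mu> \<Omega> (strip \<Omega> \<rho>) h \<and> (\<forall>x\<in>strip \<Omega> \<rho>. h x > 0))"

text \<open>The filter of the limit in which x stays in \<Omega> and its distance to the boundary tends to 0.\<close>
definition to_boundary :: "'a::euclidean_space set \<Rightarrow> 'a filter" where
  "to_boundary \<Omega> = (INF \<rho>\<in>{0<..}. principal (strip \<Omega> \<rho>))"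

lemma eventually_to_boundary:
  "eventually P (to_boundary \<Omega>) \<longleftrightarrow> (\<exists>\<rho>>0. \<forall>x\<in>\<Omega>. bdist \<Omega> x < \<rho> \<longrightarrow> P x)"
proof -
  have "eventually P (to_boundary \<Omega>) \<longleftrightarrow>
      (\<exists>\<rho>\<in>{0<..}. eventually P (principal (strip \<Omega> \<rho>)))"
    unfolding to_boundary_def
  proof (rule eventually_INF_base)
    fix a b :: real
    assume "a \<in> {0<..}" "b \<in> {0<..}"
    then show "\<exists>x\<in>{0<..}. principal (strip \<Omega> x) \<le>
        inf (principal (strip \<Omega> a)) (principal (strip \<Omega> b))"
      by (intro bexI[of _ "min a b"]) (auto simp: strip_def)
  qed (auto intro: exI[of _ 1])
  then show ?thesis
    by (auto simp: eventually_principal strip_def)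
qed

end

theory Submission imports Defs begin

text \<open>
  Suppose (i) fails for the super-harmonic \<open>H'\<close>, and let \<open>H\<close> be any positive local super-harmonic.
  Choose \<open>C\<close> with \<open>h \<le> C H\<close> on a compact annulus around the boundary. For \<open>\<epsilon> > 0\<close> put
  \<open>V = C H + \<epsilon> H'\<close>. Near the boundary \<open>h \<le> \<epsilon> H'\<close>, so \<open>h \<le> V\<close> off a compact set. With \<open>t = h / V\<close> and
  \<open>g\<close> smooth, zero on \<open>(- \<infinity>, 1]\<close> and strictly increasing on \<open>[1, \<infinity>)\<close>, test \<open>h\<close> against \<open>V g(t)\<close> and
  \<open>V\<close> against \<open>h g(t)\<close>. The potential terms coincide, and subtracting leaves
  \<open>\<integral> V\<^sup>2 g'(t) |\<nabla>t|\<^sup>2 \<le> 0\<close>. Hence \<open>g(t)\<close> has zero gradient and compact support, so \<open>h \<le> V\<close>, and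
  \<open>\<epsilon> \<rightarrow> 0\<close> gives \<open>h \<le> C H\<close>.
\<close>

section \<open>Smooth functions and a mollifier\<close>

text \<open>The classical test function would be the positive part of \<open>h - V\<close>, which
  requires a chain rule for a function that is only Lipschitz; with a smooth \<open>g\<close> every
  composition is C^1. The pair \<open>V g(t)\<close>, \<open>h g(t)\<close> is chosen because both
  potential terms then carry the same factor \<open>h V g(t)\<close>. In
  \<open>\<nabla>h . \<nabla>(V g) - \<nabla>V . \<nabla>(h g)\<close> the terms without
  \<open>\<nabla>g\<close> cancel as well, and
  \<open>V \<nabla>h - h \<nabla>V = V^2 \<nabla>t\<close> turns the rest into a square with weight
  \<open>g'(t)\<close>. The function \<open>h g(t)\<close> is an admissible nonnegative test
  function because \<open>g(t) > 0\<close> forces \<open>h > V > 0\<close>. What remains is calculus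
  for continuous functions with a weak gradient in L^2_loc: mollification yields the C^1 chain rule,
  and sums, products and quotients follow from it.\<close>

lemma Ck_imp_continuous: "Ck k f \<Longrightarrow> continuous_on UNIV f"
  by (cases k) (auto intro: differentiable_imp_continuous_on)

lemma Ck_SucD: "Ck (Suc k) f \<Longrightarrow> Ck k f"
proof (induction k arbitrary: f)
  case 0
  then show ?case by (auto intro: differentiable_imp_continuous_on)
next
  case (Suc k)
  then show ?case by (metis Ck.simps(2))
qed

lemma Ck_Suc_has_derivative:
  assumes "Ck (Suc k) f"
  shows "(f has_derivative frechet_derivative f (at x)) (at x)"
  using assms by (simp add: differentiable_on_def frechet_derivative_works)

text \<open>Derivatives are unique, so an explicitly computed \<open>D\<close> may replace
  \<open>frechet_derivative\<close>. The closure rules for \<open>Ck\<close> rest on this.\<close>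

lemma Ck_SucI:
  assumes "\<And>x. (f has_derivative D x) (at x)" "\<And>v. Ck k (\<lambda>x. D x v)"
  shows "Ck (Suc k) f"
proof -
  have "frechet_derivative f (at x) = D x" for x
    using frechet_derivative_at[OF assms(1)] by metis
  then show ?thesis
    using assms by (auto simp: differentiable_on_def intro: differentiableI)
qed

lemma Ck_const: "Ck k (\<lambda>x. c)"
proof (induction k arbitrary: c)
  case (Suc k)
  show ?case
    by (rule Ck_SucI[where D = "\<lambda>_ _. 0"]) (auto intro: Suc)
qed auto

lemma Ck_add: "Ck k f \<Longrightarrow> Ck k g \<Longrightarrow> Ck k (\<lambda>x. f x + g x)"
proof (induction k arbitrary: f g)
  case 0
  then show ?case by (auto intro: continuous_on_add)
next
  case (Suc k)
  show ?case
    by (rule Ck_SucI[OF has_derivative_add[OF Ck_Suc_has_derivative Ck_Suc_has_derivative]])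
       (use Suc in auto)
qed

lemma Ck_mult: "Ck k f \<Longrightarrow> Ck k g \<Longrightarrow> Ck k (\<lambda>x. f x * g x)"
proof (induction k arbitrary: f g)
  case 0
  then show ?case by (auto intro: continuous_on_mult)
next
  case (Suc k)
  show ?case
    by (rule Ck_SucI[OF has_derivative_mult[OF Ck_Suc_has_derivative Ck_Suc_has_derivative]])
       (use Suc Ck_SucD[OF Suc.prems(1)] Ck_SucD[OF Suc.prems(2)] in \<open>auto intro!: Ck_add Suc.IH\<close>)
qed

lemma Ck_inner_left: "Ck k (\<lambda>x. x \<bullet> v)"
proof (cases k)
  case 0
  then show ?thesis by (simp add: continuous_on_inner)
next
  case (Suc j)
  show ?thesis unfolding Suc
    by (rule Ck_SucI[where D = "\<lambda>_ w. w \<bullet> v"]) (auto intro: Ck_const derivative_eq_intros)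
qed

lemma Ck_norm_sq: "Ck k (\<lambda>x::'a::euclidean_space. x \<bullet> x)"
proof (cases k)
  case 0
  then show ?thesis by (simp add: continuous_on_inner)
next
  case (Suc j)
  have "Ck j (\<lambda>x::'a. x \<bullet> v + v \<bullet> x)" for v
    using Ck_add[OF Ck_inner_left Ck_inner_left, of j v v] by (simp add: inner_commute)
  then show ?thesis unfolding Suc
    by (intro Ck_SucI[where D = "\<lambda>x w. x \<bullet> w + w \<bullet> x"]) (auto intro: derivative_eq_intros)
qed

text \<open>The family is closed under differentiation up to linear combinations, which makes it smooth.\<close>

definition flat :: "nat \<Rightarrow> real \<Rightarrow> real" where
  "flat n x = (if x > 0 then (1 / x) ^ n / exp (1 / x) else 0)"

text \<open>From the right, \<open>y = 1 / x\<close> turns this into the limit of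
  \<open>y ^ n / exp y\<close> at infinity; from the left the function is constantly 0.\<close>

lemma flat_tendsto_0: "((flat n) \<longlongrightarrow> 0) (at 0)"
proof -
  have "((\<lambda>x::real. (1 / x) ^ n / exp (1 / x)) \<longlongrightarrow> 0) (at_right 0)"
    by (rule filterlim_compose[OF tendsto_power_div_exp_0])
       (use filterlim_inverse_at_top_right in \<open>simp add: inverse_eq_divide\<close>)
  then have "((flat n) \<longlongrightarrow> 0) (at_right 0)"
    by (rule Lim_transform_eventually) (auto simp: flat_def eventually_at_filter)
  moreover have "((flat n) \<longlongrightarrow> 0) (at_left 0)"
    by (rule Lim_transform_eventually[OF tendsto_const]) (auto simp: flat_def eventually_at_filter)
  ultimately show ?thesis by (simp add: filterlim_split_at)
qed

lemma flat_has_derivative: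
  "(flat n has_real_derivative (flat (n + 2) x - real n * flat (n + 1) x)) (at x)"
proof (cases x "0::real" rule: linorder_cases)
  case less
  have "((\<lambda>x. 0) has_real_derivative 0) (at x)" by simp
  then have "(flat n has_real_derivative 0) (at x)"
    by (rule has_field_derivative_transform_within_open[of _ _ _ "{..<0}"])
       (use less in \<open>auto simp: flat_def\<close>)
  then show ?thesis using less by (simp add: flat_def)
next
  case equal
  \<comment> \<open>Away from 0 the difference quotient of \<open>flat n\<close> at 0 is exactly
    \<open>flat (Suc n)\<close>, so the previous limit gives derivative 0.\<close>
  have "((\<lambda>y. (flat n y - flat n 0) / (y - 0)) \<longlongrightarrow> 0) (at 0)"
    by (rule Lim_transform_eventually[OF flat_tendsto_0[of "Suc n"]])
       (auto simp: flat_def eventually_at_filter divide_simps)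
  then show ?thesis using equal by (simp add: flat_def has_field_derivative_iff)
next
  case greater
  have "((\<lambda>x. (1 / x) ^ n / exp (1 / x)) has_real_derivative
      (flat (n + 2) x - real n * flat (n + 1) x)) (at x)"
    using greater
    apply (cases n)
     apply (auto intro!: derivative_eq_intros simp: flat_def)
    apply (auto simp: field_simps power2_eq_square)
    subgoal for m by (cases m) (simp_all add: mult_ac)
    done
  then show ?thesis
    by (rule has_field_derivative_transform_within_open[of _ _ _ "{0<..}"])
       (use greater in \<open>auto simp: flat_def\<close>)
qed

text \<open>One differentiation raises the index \<open>n\<close>, so the induction on
  \<open>k\<close> must leave \<open>n\<close> free. The inner function \<open>u\<close> stays fixed
  throughout.\<close>

lemma Ck_flat: "Ck k u \<Longrightarrow> Ck k (\<lambda>x. flat n (u x))"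
proof (induction k arbitrary: n)
  case 0
  have "continuous_on UNIV (flat n)"
    using flat_has_derivative by (meson DERIV_isCont continuous_at_imp_continuous_on)
  then show ?case using 0 by (simp add: continuous_on_compose2)
next
  case (Suc k)
  let ?D = "\<lambda>x. frechet_derivative u (at x)"
  have "((\<lambda>x. flat n (u x)) has_derivative
      (\<lambda>v. ((flat (n + 2) (u x) + (- real n) * flat (n + 1) (u x))) * ?D x v)) (at x)" for x
    using has_derivative_compose[OF Ck_Suc_has_derivative[OF Suc.prems, of x]
        flat_has_derivative[THEN has_field_derivative_imp_has_derivative, of n "u x"]]
    by simp
  then show ?case
  proof (rule Ck_SucI)
    show "Ck k (\<lambda>x. (flat (n + 2) (u x) + (- real n) * flat (n + 1) (u x)) * ?D x v)" for v
      by (intro Ck_mult Ck_add Ck_const Suc.IH Ck_SucD[OF Suc.prems]) (use Suc.prems in simp)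
  qed
qed

lemma flat_nonneg: "flat n x \<ge> 0" and flat_pos: "x > 0 \<Longrightarrow> flat n x > 0"
  and flat_zero: "x \<le> 0 \<Longrightarrow> flat n x = 0"
  by (auto simp: flat_def)

section \<open>Integrals of continuous functions, and the mollifier\<close>

lemma integrable_compact_support:
  fixes f :: "'a::euclidean_space \<Rightarrow> 'b::euclidean_space"
  assumes "compact K" "continuous_on K f" "\<And>x. x \<notin> K \<Longrightarrow> f x = 0"
  shows "integrable lebesgue f"
proof -
  have "integrable lborel (\<lambda>x. indicator K x *\<^sub>R f x)"
    by (rule borel_integrable_compact[OF assms(1,2)])
  moreover have "(\<lambda>x. indicator K x *\<^sub>R f x) = f"
    using assms(3) by (auto simp: indicator_def)
  ultimately show ?thesis by (metis integrable_completion borel_measurable_integrable)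
qed

text \<open>A nonzero value would make the nonvanishing set inside \<open>G\<close> a nonempty open
  set, and such a set is not negligible.\<close>

lemma AE_zero_on_open:
  fixes f :: "'a::euclidean_space \<Rightarrow> real"
  assumes "open G" "continuous_on G f" "AE x in lebesgue. x \<in> G \<longrightarrow> f x = 0" "x \<in> G"
  shows "f x = 0"
proof (rule ccontr)
  assume "f x \<noteq> 0"
  have "open (G \<inter> f -` (- {0}))"
    by (rule continuous_open_preimage[OF assms(2,1)]) auto
  moreover have "negligible (G \<inter> f -` (- {0}))"
  proof -
    have "{x \<in> space lebesgue. \<not> (x \<in> G \<longrightarrow> f x = 0)} \<in> null_sets lebesgue"
      using assms(3) by (simp only: completion.AE_iff_null_sets)
    moreover have "{x \<in> space lebesgue. \<not> (x \<in> G \<longrightarrow> f x = 0)} = G \<inter> f -` (- {0})"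
      by auto
    ultimately show ?thesis by (simp add: negligible_iff_null_sets)
  qed
  moreover have "x \<in> G \<inter> f -` (- {0})" using assms \<open>f x \<noteq> 0\<close> by auto
  ultimately show False using open_not_negligible by blast
qed

lemma mollifier_exists:
  assumes "\<epsilon> > 0"
  obtains \<rho> :: "'a::euclidean_space \<Rightarrow> real" where "smooth \<rho>" "\<And>x. \<rho> x \<ge> 0"
    "\<And>x. norm x \<ge> \<epsilon> \<Longrightarrow> \<rho> x = 0" "(LINT x|lebesgue. \<rho> x) = 1"
proof -
  \<comment> \<open>The classical bump exp(-1/(\<epsilon>^2 - |x|^2)), written with the inner
    product because the norm itself is not differentiable at 0.\<close>
  define \<sigma> :: "'a \<Rightarrow> real" where "\<sigma> x = flat 0 (\<epsilon>\<^sup>2 + (-1) * (x \<bullet> x))" for x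
  have sm: "smooth \<sigma>" unfolding smooth_def \<sigma>_def
    by (intro allI Ck_flat Ck_add Ck_const Ck_mult Ck_norm_sq)
  have z: "\<sigma> x = 0" if "norm x \<ge> \<epsilon>" for x
    using that assms unfolding \<sigma>_def
    by (intro flat_zero) (simp flip: power2_norm_eq_inner)
  have nn: "\<sigma> x \<ge> 0" for x by (simp add: \<sigma>_def flat_nonneg)
  have cont: "continuous_on UNIV \<sigma>" using sm Ck_imp_continuous smooth_def by blast
  have int: "integrable lebesgue \<sigma>"
    by (rule integrable_compact_support[of "cball 0 \<epsilon>"]) (auto intro: z continuous_on_subset[OF cont])
  have pos: "(LINT x|lebesgue. \<sigma> x) > 0"
  proof -
    have "(LINT x|lebesgue. \<sigma> x) \<noteq> 0"
    proof
      assume "(LINT x|lebesgue. \<sigma> x) = 0"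
      then have "AE x in lebesgue. \<sigma> x = 0"
        using integral_nonneg_eq_0_iff_AE[OF int] nn by auto
      then have "AE x in lebesgue. x \<in> UNIV \<longrightarrow> \<sigma> x = 0" by simp
      then have "\<sigma> 0 = 0"
        using AE_zero_on_open[OF open_UNIV cont, of 0] by blast
      moreover have "\<sigma> 0 > 0"
        unfolding \<sigma>_def using assms by (intro flat_pos) simp
      ultimately show False by simp
    qed
    then show ?thesis using Bochner_Integration.integral_nonneg[of lebesgue \<sigma>] nn by fastforce
  qed
  show thesis
  proof (rule that[of "\<lambda>x. inverse (LINT x|lebesgue. \<sigma> x) * \<sigma> x"])
    show "smooth (\<lambda>x. inverse (LINT x|lebesgue. \<sigma> x) * \<sigma> x)"
      using sm unfolding smooth_def by (intro allI Ck_mult Ck_const) auto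
  qed (use z nn pos in auto)
qed

section \<open>Convolution with functions of compact support\<close>

text \<open>Uniform continuity on \<open>C\<close> alone says nothing about points \<open>t\<close>
  off \<open>C\<close>, so it is used on a compact neighbourhood of \<open>C\<close> that still lies
  in \<open>S\<close>.\<close>

lemma compact_uniform_neighbourhood:
  fixes f :: "'a::heine_borel \<Rightarrow> 'b::metric_space"
  assumes "open S" "compact C" "C \<subseteq> S" "continuous_on S f" "e > 0"
  obtains d where "d > 0" "\<And>s t. s \<in> C \<Longrightarrow> dist s t \<le> d \<Longrightarrow> t \<in> S \<and> dist (f s) (f t) < e"
proof -
  obtain r where r: "r > 0" "(\<Union>x\<in>C. cball x r) \<subseteq> S"
    using compact_subset_open_imp_cball_epsilon_subset[OF assms(2,1,3)] .
  let ?N = "\<Union>x\<in>C. cball x r"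
  have "uniformly_continuous_on ?N f"
    using r(2) assms(2,4)
    by (intro compact_uniformly_continuous compact_minkowski_sum_cball) (auto intro: continuous_on_subset)
  then obtain d where d: "d > 0" "\<And>s t. s \<in> ?N \<Longrightarrow> t \<in> ?N \<Longrightarrow> dist t s < d \<Longrightarrow> dist (f t) (f s) < e"
    using \<open>e > 0\<close> unfolding uniformly_continuous_on_def by metis
  show thesis
  proof
    fix s t assume st: "s \<in> C" "dist s t \<le> min r (d / 2)"
    then have "s \<in> cball s r" "t \<in> cball s r" "dist t s < d"
      using r d(1) by (auto simp: dist_commute)
    then have "s \<in> ?N" "t \<in> ?N" using st(1) by blast+
    then show "t \<in> S \<and> dist (f s) (f t) < e"
      using subsetD[OF r(2)] d(2)[of s t] \<open>dist t s < d\<close> by (simp add: dist_commute)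
  qed (use r d in auto)
qed

lemma bounded_compact_support:
  fixes f :: "'a::euclidean_space \<Rightarrow> real"
  assumes "compact K" "continuous_on K f" "\<And>x. x \<notin> K \<Longrightarrow> f x = 0"
  obtains B where "B \<ge> 0" "\<And>x. \<bar>f x\<bar> \<le> B"
proof -
  have "bounded (f ` K)" using assms by (intro compact_imp_bounded compact_continuous_image)
  then obtain B where "\<forall>x\<in>K. norm (f x) \<le> B" by (auto simp: bounded_iff)
  then have "\<bar>f x\<bar> \<le> \<bar>B\<bar>" for x using assms(3) by (cases "x \<in> K") force+
  then show thesis using that[of "\<bar>B\<bar>"] by auto
qed

lemma integrable_indicator_compact:
  fixes K :: "'a::euclidean_space set"
  assumes "compact K"
  shows "integrable lebesgue (indicator K :: 'a \<Rightarrow> real)"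
  by (rule integrable_compact_support[OF assms])
     (auto intro: continuous_on_eq[OF continuous_on_const[of K 1]])

lemma integrable_mult_bounded:
  fixes U f :: "'a \<Rightarrow> real"
  assumes "integrable M U" "f \<in> borel_measurable M" "\<And>x. x \<in> space M \<Longrightarrow> \<bar>f x\<bar> \<le> B"
  shows "integrable M (\<lambda>x. U x * f x)"
proof (rule Bochner_Integration.integrable_bound)
  show "integrable M (\<lambda>x. B * U x)" using assms by simp
  show "AE x in M. norm (U x * f x) \<le> norm (B * U x)"
  proof (rule AE_I2)
    fix x assume "x \<in> space M"
    then have "\<bar>f x\<bar> \<le> \<bar>B\<bar>" using assms(3) by fastforce
    then show "norm (U x * f x) \<le> norm (B * U x)"
      using mult_left_mono[of "\<bar>f x\<bar>" "\<bar>B\<bar>" "\<bar>U x\<bar>"]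
      by (simp add: abs_mult mult.commute)
  qed
qed (use assms in auto)

lemma borel_measurable_continuous_lebesgue:
  fixes f :: "'a::euclidean_space \<Rightarrow> 'b::topological_space"
  shows "continuous_on UNIV f \<Longrightarrow> f \<in> borel_measurable lebesgue"
  by (intro measurable_completion) (simp add: borel_measurable_continuous_onI)

text \<open>Both are affine substitutions \<open>t + c *\<^sub>R x\<close> with
  \<open>\<bar>c\<bar> = 1\<close>, so the density factor is 1. Continuity supplies the Borel
  measurability that carries the result from \<open>lborel\<close> to its completion.\<close>

lemma lebesgue_integral_reflect_translate:
  fixes f :: "'a::euclidean_space \<Rightarrow> real"
  assumes f: "continuous_on UNIV f"
  shows "(LINT x|lebesgue. f (x - y)) = (LINT x|lebesgue. f x)"
    and "(LINT x|lebesgue. f (y - x)) = (LINT x|lebesgue. f x)"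
proof -
  have f': "f \<in> borel_measurable lborel"
    using borel_measurable_continuous_onI[OF f] by simp
  have *: "(LINT x|lebesgue. f (t + c *\<^sub>R x)) = (LINT x|lebesgue. f x)" if "\<bar>c\<bar> = 1" for c t
  proof -
    have c: "c \<noteq> 0" using that by auto
    have "lborel = density (distr lborel borel (\<lambda>x::'a. t + c *\<^sub>R x)) (\<lambda>_. 1)"
      using lborel_affine[OF c, of t] that by simp
    then have "lborel = distr lborel borel (\<lambda>x::'a. t + c *\<^sub>R x)" by (simp add: density_1)
    then have "(LINT x|lborel. f x) = (LINT x|distr lborel borel (\<lambda>x::'a. t + c *\<^sub>R x). f x)"
      by metis
    also have "\<dots> = (LINT x|lborel. f (t + c *\<^sub>R x))"
      using f' by (intro integral_distr) auto
    finally have "(LINT x|lborel. f (t + c *\<^sub>R x)) = (LINT x|lborel. f x)" by simp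
    moreover have "(\<lambda>x. f (t + c *\<^sub>R x)) \<in> borel_measurable lborel"
      using f' by simp
    ultimately show ?thesis using f' by (simp add: integral_completion)
  qed
  show "(LINT x|lebesgue. f (x - y)) = (LINT x|lebesgue. f x)"
    using *[of 1 "- y"] by simp
  show "(LINT x|lebesgue. f (y - x)) = (LINT x|lebesgue. f x)"
    using *[of "-1" y] by simp
qed

lemma derivative_zero_off_support:
  fixes f :: "'a::real_normed_vector \<Rightarrow> real"
  assumes "(f has_derivative D) (at z)" "open N" "z \<in> N" "\<And>w. w \<in> N \<Longrightarrow> f w = 0"
  shows "D v = 0"
proof -
  have "((\<lambda>_. 0) has_derivative D) (at z)"
    by (rule has_derivative_transform_within_open[OF assms(1-3)]) (use assms(4) in auto)
  then have "D = (\<lambda>_. 0)" by (rule has_derivative_unique) simp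
  then show ?thesis by simp
qed

text \<open>Requiring C^1 only lets the locale serve twice: for mollifiers, and for products
  \<open>F (v y) * \<phi> y\<close> where \<open>F\<close> is merely C^1.\<close>

locale C1_compact_support =
  fixes \<rho> :: "'a::euclidean_space \<Rightarrow> real" and D and R :: real
  assumes deriv: "\<And>z. (\<rho> has_derivative D z) (at z)"
    and cont_D: "\<And>v. continuous_on UNIV (\<lambda>z. D z v)"
    and supp: "\<And>z. norm z \<ge> R \<Longrightarrow> \<rho> z = 0"
begin

lemma cont: "continuous_on UNIV \<rho>"
  using deriv by (meson has_derivative_continuous continuous_at_imp_continuous_on)

lemma supp_D: "norm z > R \<Longrightarrow> D z v = 0"
  by (rule derivative_zero_off_support[OF deriv, of "- cball 0 R"])
     (auto intro: supp simp: closed_open[symmetric])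

lemma bounded: obtains B where "B \<ge> 0" "\<And>x. \<bar>\<rho> x\<bar> \<le> B"
  by (rule bounded_compact_support[of "cball 0 R" \<rho>]) (auto intro: supp continuous_on_subset[OF cont])

lemma bounded_D: obtains B where "B \<ge> 0" "\<And>x. \<bar>D x v\<bar> \<le> B"
  by (rule bounded_compact_support[of "cball 0 R" "\<lambda>x. D x v"])
     (auto intro: supp_D continuous_on_subset[OF cont_D])

lemma integrable_conv:
  assumes "integrable lebesgue U"
  shows "integrable lebesgue (\<lambda>x. U x * \<rho> (x - y))" "integrable lebesgue (\<lambda>x. U x * D (x - y) v)"
proof -
  obtain B where B: "\<And>x. \<bar>\<rho> x\<bar> \<le> B" using bounded by blast
  obtain B' where B': "\<And>x. \<bar>D x v\<bar> \<le> B'" using bounded_D by blast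
  show "integrable lebesgue (\<lambda>x. U x * \<rho> (x - y))"
    by (rule integrable_mult_bounded[OF assms, where B = B])
       (auto intro!: borel_measurable_continuous_lebesgue continuous_on_compose2[OF cont] continuous_intros B)
  show "integrable lebesgue (\<lambda>x. U x * D (x - y) v)"
    by (rule integrable_mult_bounded[OF assms, where B = B'])
       (auto intro!: borel_measurable_continuous_lebesgue continuous_on_compose2[OF cont_D] continuous_intros B')
qed

lemma uniform_D:
  assumes "e > 0"
  obtains d where "d > 0" "\<And>z w. dist z w \<le> d \<Longrightarrow> onorm (D w - D z) \<le> e"
proof -
  \<comment> \<open>The operator norm is controlled by summing over the \<open>DIM('a)\<close> basis
    directions, each of which receives an equal share of \<open>e\<close>.\<close>
  let ?e = "e / DIM('a)"
  have "\<exists>d>0. \<forall>z w. dist z w \<le> d \<longrightarrow> \<bar>D w b - D z b\<bar> \<le> ?e" for b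
  proof -
    have "?e > 0" using assms by simp
    then obtain d where d: "d > 0"
      "\<And>z w. z \<in> cball 0 (R + 1) \<Longrightarrow> dist z w \<le> d \<Longrightarrow> dist (D z b) (D w b) < ?e"
      using compact_uniform_neighbourhood[OF open_UNIV compact_cball subset_UNIV cont_D] by metis
    \<comment> \<open>Steps have length at most 1, so if \<open>z\<close> is outside the ball of
      radius \<open>R + 1\<close>, then \<open>w\<close> is outside the ball of radius
      \<open>R\<close> and both derivatives vanish.\<close>
    have "\<bar>D w b - D z b\<bar> \<le> ?e" if "dist z w \<le> min d 1" for z w
    proof (cases "z \<in> cball 0 (R + 1)")
      case True
      then show ?thesis using d(2)[of z w] that by (auto simp: dist_real_def)
    next
      case False
      have "norm z \<le> norm w + dist z w" by norm
      then have "norm z > R" "norm w > R" using False that by auto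
      then show ?thesis using assms by (simp add: supp_D)
    qed
    then show ?thesis using d(1) by (intro exI[of _ "min d 1"]) auto
  qed
  then obtain d where d: "\<And>b. d b > 0" "\<And>b z w. dist z w \<le> d b \<Longrightarrow> \<bar>D w b - D z b\<bar> \<le> ?e"
    by metis
  define d0 where "d0 = Min (d ` Basis)"
  have d0: "d0 > 0" "\<And>b. b \<in> Basis \<Longrightarrow> d0 \<le> d b" unfolding d0_def using d(1) by auto
  show thesis
  proof (rule that[OF d0(1)])
    fix z w :: 'a assume zw: "dist z w \<le> d0"
    have lin: "linear (\<lambda>v. D w v - D z v)"
      using has_derivative_bounded_linear[OF deriv]
      by (intro bounded_linear.linear bounded_linear_sub)
    show "onorm (D w - D z) \<le> e"
    proof (rule onorm_le)
      fix v
      have "D w v - D z v = (\<Sum>b\<in>Basis. (v \<bullet> b) * (D w b - D z b))"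
        using linear_sum[OF lin, of "\<lambda>b. (v \<bullet> b) *\<^sub>R b" Basis]
        by (simp add: euclidean_representation linear_cmul[OF lin])
      also have "norm \<dots> \<le> (\<Sum>b\<in>(Basis::'a set). norm v * ?e)"
      proof (rule sum_norm_le)
        fix b :: 'a assume b: "b \<in> Basis"
        have "\<bar>D w b - D z b\<bar> \<le> ?e" using d(2) d0(2)[OF b] zw by fastforce
        then show "norm ((v \<bullet> b) * (D w b - D z b)) \<le> norm v * ?e"
          using mult_mono[OF Basis_le_norm[OF b, of v], of "\<bar>D w b - D z b\<bar>" ?e] by (simp add: abs_mult)
      qed
      also have "\<dots> = e * norm v" by simp
      finally show "norm ((D w - D z) v) \<le> e * norm v" by simp
    qed
  qed
qed

text \<open>By the mean value bound and \<open>uniform_D\<close>, the first-order remainder of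
  \<open>\<rho>\<close> is small uniformly in the base point, so it stays small after integration
  against \<open>\<bar>U\<bar>\<close>. The minus sign arises because \<open>y\<close> enters as
  \<open>x - y\<close>.\<close>

lemma conv_has_derivative:
  assumes U: "integrable lebesgue U"
  shows "((\<lambda>y. LINT x|lebesgue. U x * \<rho> (x - y)) has_derivative
          (\<lambda>v. - (LINT x|lebesgue. U x * D (x - y) v))) (at y)"
  unfolding has_derivative_at_alt
proof (intro conjI allI impI)
  have lin: "linear (D z)" for z
    by (intro bounded_linear.linear has_derivative_bounded_linear[OF deriv])
  show "bounded_linear (\<lambda>v. - (LINT x|lebesgue. U x * D (x - y) v))"
    unfolding linear_conv_bounded_linear[symmetric]
    by (rule linearI)
       (simp_all add: linear_add[OF lin] linear_cmul[OF lin] distrib_left integrable_conv(2)[OF U]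
          mult.left_commute)
  fix e :: real assume "e > 0"
  define I where "I = (LINT x|lebesgue. \<bar>U x\<bar>)"
  have I: "I \<ge> 0" by (simp add: I_def)
  \<comment> \<open>The summand 1 keeps the divisor positive when \<open>U\<close> vanishes almost
    everywhere.\<close>
  have "e / (I + 1) > 0" using I \<open>e > 0\<close> by simp
  from uniform_D[OF this] obtain d
    where d: "d > 0" "\<And>z w. dist z w \<le> d \<Longrightarrow> onorm (D w - D z) \<le> e / (I + 1)" by blast
  show "\<exists>d>0. \<forall>y'. norm (y' - y) < d \<longrightarrow>
      norm ((LINT x|lebesgue. U x * \<rho> (x - y')) - (LINT x|lebesgue. U x * \<rho> (x - y))
        - - (LINT x|lebesgue. U x * D (x - y) (y' - y))) \<le> e * norm (y' - y)"
  proof (intro exI[of _ d] conjI allI impI d(1))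
    fix y' assume y': "norm (y' - y) < d"
    define v where "v = y' - y"
    have rem: "\<bar>\<rho> (z - v) - \<rho> z + D z v\<bar> \<le> norm v * (e / (I + 1))" for z
    proof -
      have "norm (\<rho> (z - v) - \<rho> z - D z (z - v - z)) \<le> norm (z - v - z) * (e / (I + 1))"
      proof (rule differentiable_bound_linearization[where S = "cball z d"])
        fix t :: real assume "t \<in> {0..1}"
        then have "t * norm v \<le> d" using y' mult_left_le_one_le[of "norm v" t] by (auto simp: v_def)
        then show "z + t *\<^sub>R (z - v - z) \<in> cball z d"
          using \<open>t \<in> {0..1}\<close> by (simp add: dist_norm)
      qed (use deriv d in \<open>auto intro: has_derivative_at_withinI\<close>)
      then show ?thesis by (simp add: linear_neg[OF lin])
    qed
    have "(LINT x|lebesgue. U x * \<rho> (x - y')) - (LINT x|lebesgue. U x * \<rho> (x - y))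
        - - (LINT x|lebesgue. U x * D (x - y) (y' - y))
      = (LINT x|lebesgue. U x * \<rho> (x - y') - U x * \<rho> (x - y) + U x * D (x - y) (y' - y))"
      using integrable_conv[OF U] by simp
    also have "\<dots> = (LINT x|lebesgue. U x * (\<rho> (x - y - v) - \<rho> (x - y) + D (x - y) v))"
      by (simp add: v_def algebra_simps)
    also have "norm \<dots> \<le> (LINT x|lebesgue. \<bar>U x\<bar> * (norm v * (e / (I + 1))))"
    proof (rule Bochner_Integration.integral_norm_bound_integral)
      have "integrable lebesgue (\<lambda>x. U x * \<rho> (x - y') - U x * \<rho> (x - y) + U x * D (x - y) (y' - y))"
        using integrable_conv[OF U] by simp
      then show "integrable lebesgue (\<lambda>x. U x * (\<rho> (x - y - v) - \<rho> (x - y) + D (x - y) v))"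
        by (simp add: v_def algebra_simps)
      show "norm (U x * (\<rho> (x - y - v) - \<rho> (x - y) + D (x - y) v)) \<le> \<bar>U x\<bar> * (norm v * (e / (I + 1)))"
        for x using mult_left_mono[OF rem[of "x - y"], of "\<bar>U x\<bar>"] by (simp add: abs_mult)
    qed (use U in auto)
    also have "\<dots> = norm v * (e * (I / (I + 1)))" by (simp add: I_def)
    also have "\<dots> \<le> norm v * (e * 1)"
      using I \<open>e > 0\<close> by (intro mult_left_mono) auto
    finally show "norm ((LINT x|lebesgue. U x * \<rho> (x - y')) - (LINT x|lebesgue. U x * \<rho> (x - y))
        - - (LINT x|lebesgue. U x * D (x - y) (y' - y))) \<le> e * norm (y' - y)"
      by (simp add: v_def mult.commute)
  qed
qed

text \<open>The integral of \<open>\<rho> (x - y)\<close> over \<open>x\<close> is independent of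
  \<open>y\<close>; differentiate in \<open>y\<close> at 0. The indicator of a ball of radius
  \<open>R + 1\<close> stands in for the constant 1, which is not integrable, and is equivalent to
  it while \<open>norm y < 1\<close>.\<close>

lemma integral_derivative_zero: "(LINT x|lebesgue. D x v) = 0"
proof -
  let ?U = "indicator (cball 0 (R + 1)) :: 'a \<Rightarrow> real"
  have U: "integrable lebesgue ?U"
    by (intro integrable_indicator_compact compact_cball)
  have *: "(LINT x|lebesgue. ?U x * \<rho> (x - y)) = (LINT x|lebesgue. \<rho> x)" if "norm y < 1" for y
  proof -
    have "?U x * \<rho> (x - y) = \<rho> (x - y)" for x
    proof (cases "x \<in> cball 0 (R + 1)")
      case False
      have "norm x \<le> norm (x - y) + norm y" by norm
      then have "\<rho> (x - y) = 0" using False that by (intro supp) auto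
      then show ?thesis by simp
    qed simp
    then show ?thesis using lebesgue_integral_reflect_translate(1)[OF cont, of y]
      by (subst Bochner_Integration.integral_cong[OF refl, of _ _ "\<lambda>x. \<rho> (x - y)"]) auto
  qed
  have "((\<lambda>_. LINT x|lebesgue. \<rho> x) has_derivative (\<lambda>v. - (LINT x|lebesgue. ?U x * D (x - 0) v))) (at 0)"
    by (rule has_derivative_transform_within_open[OF conv_has_derivative[OF U, of 0], of "ball 0 1"])
       (auto simp: *)
  then have "(\<lambda>v. - (LINT x|lebesgue. ?U x * D (x - 0) v)) = (\<lambda>_. 0)"
    by (rule has_derivative_unique) simp
  then have "- (LINT x|lebesgue. ?U x * D (x - 0) v) = 0" by metis
  moreover have "?U x * D x v = D x v" for x
    using supp_D[of x v] by (cases "x \<in> cball 0 (R + 1)") auto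
  ultimately show ?thesis by simp
qed

end

lemma smooth_derivative: "smooth f \<Longrightarrow> smooth (\<lambda>x. frechet_derivative f (at x) v)"
  unfolding smooth_def by (metis Ck.simps(2))

lemma smooth_has_derivative: "smooth f \<Longrightarrow> (f has_derivative frechet_derivative f (at x)) (at x)"
  unfolding smooth_def using Ck_Suc_has_derivative by blast

lemma smooth_imp_continuous: "smooth f \<Longrightarrow> continuous_on UNIV f"
  unfolding smooth_def using Ck_imp_continuous by blast

lemma smooth_mult: "smooth f \<Longrightarrow> smooth g \<Longrightarrow> smooth (\<lambda>x. f x * g x)"
  unfolding smooth_def using Ck_mult by blast

lemma C1_compact_support_smooth:
  assumes "smooth \<rho>" "\<And>z. norm z \<ge> R \<Longrightarrow> \<rho> z = 0"
  shows "C1_compact_support \<rho> (\<lambda>z. frechet_derivative \<rho> (at z)) R"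
  using assms smooth_has_derivative smooth_derivative smooth_imp_continuous
  by unfold_locales blast+

text \<open>Differentiating only replaces the kernel by one of its derivatives, so the induction
  leaves both \<open>\<rho>\<close> and \<open>R\<close> free.\<close>

lemma smooth_conv:
  assumes "integrable lebesgue U" "smooth \<rho>" "\<And>z. norm z \<ge> R \<Longrightarrow> \<rho> z = 0"
  shows "smooth (\<lambda>y. LINT x|lebesgue. U x * \<rho> (x - y))"
proof -
  have "Ck k (\<lambda>y. LINT x|lebesgue. U x * \<rho> (x - y))" for k
    using assms(2,3)
  proof (induction k arbitrary: \<rho> R)
    case 0
    interpret C1_compact_support \<rho> "\<lambda>z. frechet_derivative \<rho> (at z)" R
      using 0 by (rule C1_compact_support_smooth)
    show ?case
      using conv_has_derivative[OF assms(1)]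
      by (auto intro!: continuous_at_imp_continuous_on has_derivative_continuous)
  next
    case (Suc k)
    interpret C1_compact_support \<rho> "\<lambda>z. frechet_derivative \<rho> (at z)" R
      using Suc.prems by (rule C1_compact_support_smooth)
    show ?case
    proof (rule Ck_SucI[OF conv_has_derivative[OF assms(1)]])
      fix v
      \<comment> \<open>\<open>supp_D\<close> needs \<open>norm z > R\<close>, whereas the induction
        hypothesis asks for vanishing from its radius onwards; hence \<open>R + 1\<close>.\<close>
      have "Ck k (\<lambda>y. (- 1) * (LINT x|lebesgue. U x * frechet_derivative \<rho> (at (x - y)) v))"
        by (intro Ck_mult Ck_const Suc.IH[of "\<lambda>z. frechet_derivative \<rho> (at z) v" "R + 1"]
            smooth_derivative Suc.prems supp_D) auto
      then show "Ck k (\<lambda>y. - (LINT x|lebesgue. U x * frechet_derivative \<rho> (at (x - y)) v))" by simp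
    qed
  qed
  then show ?thesis by (simp add: smooth_def)
qed

section \<open>Test functions and cutoffs\<close>

lemma test_functionI:
  assumes "smooth \<phi>" "compact K" "K \<subseteq> G" "\<And>x. x \<notin> K \<Longrightarrow> \<phi> x = 0"
  shows "test_function G \<phi>"
proof -
  have sub: "closure {x. \<phi> x \<noteq> 0} \<subseteq> K"
    using assms by (intro closure_minimal) (auto intro: compact_imp_closed)
  then have "compact (closure {x. \<phi> x \<noteq> 0})"
    using assms(2) by (meson bounded_subset closed_closure compact_eq_bounded_closed)
  then show ?thesis using sub assms unfolding test_function_def by blast
qed

text \<open>Being 1 on an open neighbourhood of \<open>K\<close>, and not just on \<open>K\<close>,
  makes the derivative of \<open>\<zeta>\<close> vanish on \<open>K\<close>, so multiplying by
  \<open>\<zeta>\<close> changes no derivative there.\<close>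

lemma smooth_cutoff:
  assumes "compact K" "open G" "K \<subseteq> G"
  obtains \<zeta> N where "test_function G \<zeta>" "open N" "K \<subseteq> N" "\<And>y. y \<in> N \<Longrightarrow> \<zeta> y = 1"
proof -
  obtain r where r: "r > 0" "(\<Union>x\<in>K. cball x r) \<subseteq> G"
    using compact_subset_open_imp_cball_epsilon_subset[OF assms] .
  \<comment> \<open>The indicator of the closed \<open>2 * e\<close>-neighbourhood of
    \<open>K\<close> is mollified at scale \<open>e\<close>: the result is 1 within distance
    \<open>e\<close> of \<open>K\<close> and 0 beyond \<open>3 * e = r\<close>.\<close>
  define e where "e = r / 3"
  have e: "e > 0" using r by (simp add: e_def)
  obtain \<rho> :: "'a \<Rightarrow> real" where \<rho>: "smooth \<rho>" "\<And>x. \<rho> x \<ge> 0" "\<And>x. norm x \<ge> e \<Longrightarrow> \<rho> x = 0"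
    "(LINT x|lebesgue. \<rho> x) = 1"
    using mollifier_exists[OF e] by metis
  let ?K1 = "\<Union>x\<in>K. cball x (2 * e)"
  let ?K2 = "\<Union>x\<in>K. cball x r"
  define U :: "'a \<Rightarrow> real" where "U = indicator ?K1"
  have cK: "compact ?K1" "compact ?K2" by (intro compact_minkowski_sum_cball assms)+
  have U: "integrable lebesgue U"
    using cK unfolding U_def by (intro integrable_indicator_compact)
  define \<zeta> where "\<zeta> y = (LINT x|lebesgue. U x * \<rho> (x - y))" for y
  have z: "\<zeta> y = 0" if "y \<notin> ?K2" for y
  proof -
    have "U x * \<rho> (x - y) = 0" for x
    proof (cases "x \<in> ?K1 \<and> norm (x - y) < e")
      case True
      then obtain k where k: "k \<in> K" "dist k x \<le> 2 * e" "dist x y < e" by (auto simp: dist_norm)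
      have "dist k y \<le> dist k x + dist x y" by (rule dist_triangle)
      then have "dist k y \<le> r" using k by (simp add: e_def)
      then show ?thesis using that k by auto
    qed (auto simp: U_def \<rho>)
    then have "(\<lambda>x. U x * \<rho> (x - y)) = (\<lambda>_. 0)" by (rule ext)
    then show ?thesis by (simp only: \<zeta>_def) simp
  qed
  have o: "\<zeta> y = 1" if "y \<in> (\<Union>x\<in>K. ball x e)" for y
  proof -
    have "U x * \<rho> (x - y) = \<rho> (x - y)" for x
    proof (cases "norm (x - y) < e")
      case True
      obtain k where k: "k \<in> K" "dist k y < e" using \<open>y \<in> _\<close> by auto
      have "dist k x \<le> dist k y + dist y x" by (rule dist_triangle)
      then have "x \<in> ?K1" using True k by (intro UN_I[OF k(1)]) (auto simp: dist_norm norm_minus_commute)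
      then show ?thesis by (simp add: U_def)
    qed (simp add: \<rho>)
    then have "(\<lambda>x. U x * \<rho> (x - y)) = (\<lambda>x. \<rho> (x - y))" by (rule ext)
    then show ?thesis
      using lebesgue_integral_reflect_translate(1)[OF smooth_imp_continuous[OF \<rho>(1)]] \<rho>(4)
      by (simp only: \<zeta>_def)
  qed
  show thesis
  proof (rule that[of \<zeta> "\<Union>x\<in>K. ball x e"])
    have "smooth \<zeta>" unfolding \<zeta>_def using U \<rho> by (intro smooth_conv[where R = e])
    then show "test_function G \<zeta>"
      using cK(2) r(2) z by (rule test_functionI)
  qed (use e o in auto)
qed

section \<open>Mollified chain rule\<close>

lemma sigma_finite_lebesgue: "sigma_finite_measure (lebesgue :: 'a::euclidean_space measure)"
proof
  from lborel.sigma_finite_countable obtain A :: "'a set set"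
    where A: "countable A" "A \<subseteq> sets lborel" "\<Union>A = space lborel" "\<forall>a\<in>A. emeasure lborel a \<noteq> \<infinity>"
    by blast
  then show "\<exists>A::'a set set. countable A \<and> A \<subseteq> sets lebesgue \<and> \<Union>A = space lebesgue
      \<and> (\<forall>a\<in>A. emeasure lebesgue a \<noteq> \<infinity>)"
    by (intro exI[of _ A]) (auto simp: emeasure_completion)
qed

text \<open>The product \<open>k x * \<theta> y\<close> is integrable on the product space, and the
  bounded factor \<open>\<rho> (x - y)\<close> preserves this.\<close>

lemma Fubini_convolution:
  fixes k \<theta> \<rho> :: "'a::euclidean_space \<Rightarrow> real"
  assumes k: "integrable lebesgue k" and \<theta>: "integrable lebesgue \<theta>"
    and \<rho>: "continuous_on UNIV \<rho>" "\<And>x. \<bar>\<rho> x\<bar> \<le> B"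
  shows "(LINT y|lebesgue. \<theta> y * (LINT x|lebesgue. k x * \<rho> (x - y)))
       = (LINT x|lebesgue. k x * (LINT y|lebesgue. \<rho> (x - y) * \<theta> y))"
    and "integrable lebesgue (\<lambda>x. k x * (LINT y|lebesgue. \<rho> (x - y) * \<theta> y))"
proof -
  interpret L: sigma_finite_measure "lebesgue :: 'a measure" by (rule sigma_finite_lebesgue)
  interpret P: pair_sigma_finite "lebesgue :: 'a measure" "lebesgue :: 'a measure" ..
  have "integrable (lebesgue \<Otimes>\<^sub>M lebesgue) (\<lambda>(x, y). k x * \<theta> y)"
  proof (rule P.Fubini_integrable)
    show "(\<lambda>(x, y). k x * \<theta> y) \<in> borel_measurable (lebesgue \<Otimes>\<^sub>M lebesgue)"
      using borel_measurable_integrable[OF k] borel_measurable_integrable[OF \<theta>] by measurable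
    have "integrable lebesgue (\<lambda>x. norm (k x) * (LINT y|lebesgue. norm (\<theta> y)))"
      using k by simp
    then show "integrable lebesgue (\<lambda>x. LINT y|lebesgue. norm (case (x, y) of (x, y) \<Rightarrow> k x * \<theta> y))"
      by (simp add: abs_mult)
  qed (use \<theta> in auto)
  moreover have "(\<lambda>p. \<rho> (fst p - snd p)) \<in> borel_measurable (lebesgue \<Otimes>\<^sub>M lebesgue)"
  proof -
    have id: "(\<lambda>x. x) \<in> borel_measurable (lebesgue :: 'a measure)"
      by (intro borel_measurable_continuous_lebesgue continuous_on_id)
    have "(\<lambda>p. fst p - snd p) \<in> borel_measurable (lebesgue \<Otimes>\<^sub>M (lebesgue :: 'a measure))"
      by (intro borel_measurable_diff measurable_compose[OF measurable_fst id]
          measurable_compose[OF measurable_snd id])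
    then show ?thesis
      using borel_measurable_continuous_onI[OF \<rho>(1)] by (rule measurable_compose)
  qed
  ultimately have "integrable (lebesgue \<Otimes>\<^sub>M lebesgue)
      (\<lambda>p. (case p of (x, y) \<Rightarrow> k x * \<theta> y) * \<rho> (fst p - snd p))"
    by (rule integrable_mult_bounded) (rule \<rho>(2))
  then have int: "integrable (lebesgue \<Otimes>\<^sub>M lebesgue) (\<lambda>(x, y). k x * \<theta> y * \<rho> (x - y))"
    by (simp add: case_prod_unfold)
  from P.Fubini_integral[OF int]
  have "(LINT y|lebesgue. LINT x|lebesgue. \<theta> y * (k x * \<rho> (x - y)))
      = (LINT x|lebesgue. LINT y|lebesgue. k x * (\<rho> (x - y) * \<theta> y))"
    by (simp add: mult_ac)
  then show "(LINT y|lebesgue. \<theta> y * (LINT x|lebesgue. k x * \<rho> (x - y)))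
       = (LINT x|lebesgue. k x * (LINT y|lebesgue. \<rho> (x - y) * \<theta> y))" by simp
  have "k x * \<theta> y * \<rho> (x - y) = k x * (\<rho> (x - y) * \<theta> y)" for x y by simp
  then have "(\<lambda>x. LINT y|lebesgue. k x * \<theta> y * \<rho> (x - y))
      = (\<lambda>x. k x * (LINT y|lebesgue. \<rho> (x - y) * \<theta> y))"
    by (simp only: integral_mult_right_zero)
  then show "integrable lebesgue (\<lambda>x. k x * (LINT y|lebesgue. \<rho> (x - y) * \<theta> y))"
    using P.integrable_fst[OF int] by simp
qed

text \<open>Integrals over different sets become comparable as integrals over the whole space.
  \<open>f\<close> and \<open>h\<close> are kept apart because \<open>f\<close> need not vanish off
  \<open>G\<close>.\<close>

lemma integral_lebesgue_on_extend_zero: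
  fixes f h :: "'a::euclidean_space \<Rightarrow> real"
  assumes "G \<in> sets lebesgue" "\<And>x. x \<in> G \<Longrightarrow> f x = h x" "\<And>x. x \<notin> G \<Longrightarrow> h x = 0"
  shows "(LINT x|lebesgue_on G. f x) = (LINT x|lebesgue. h x)"
proof -
  have "(\<lambda>x. if x \<in> G then f x else 0) = h" using assms by auto
  then show ?thesis using Lebesgue_Measure.integral_restrict_UNIV[OF assms(1), of f] by simp
qed

lemma Ck_translate: "Ck k \<rho> \<Longrightarrow> Ck k (\<lambda>x. \<rho> (x - y))"
proof (induction k arbitrary: \<rho>)
  case 0
  then show ?case by (auto intro!: continuous_on_compose2[of UNIV \<rho>] continuous_intros)
next
  case (Suc k)
  have "((\<lambda>x. \<rho> (x - y)) has_derivative frechet_derivative \<rho> (at (x - y))) (at x)" for x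
    by (rule has_derivative_compose[of "\<lambda>x. x - y" "\<lambda>h. h" x UNIV \<rho>])
       (auto intro: Ck_Suc_has_derivative[OF Suc.prems] derivative_eq_intros)
  then show ?case by (rule Ck_SucI) (use Suc in auto)
qed

lemma smooth_translate: "smooth \<rho> \<Longrightarrow> smooth (\<lambda>x. \<rho> (x - y))"
  by (simp add: smooth_def Ck_translate)

lemma frechet_derivative_translate:
  assumes "smooth \<rho>"
  shows "frechet_derivative (\<lambda>x. \<rho> (x - y)) (at x) = frechet_derivative \<rho> (at (x - y))"
proof -
  have "((\<lambda>x. \<rho> (x - y)) has_derivative frechet_derivative \<rho> (at (x - y))) (at x)"
    by (rule has_derivative_compose[of "\<lambda>x. x - y" "\<lambda>h. h" x UNIV \<rho>])
       (auto intro: smooth_has_derivative[OF assms] derivative_eq_intros)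
  then show ?thesis by (rule frechet_derivative_at[symmetric])
qed

text \<open>The weak gradient is tested with the translate of \<open>\<rho>\<close> centred at
  \<open>y\<close>. Functions that are only locally integrable cannot be convolved globally, so
  \<open>u\<close> and \<open>g\<close> are cut off to a set \<open>T\<close> containing the support
  of this translate.\<close>

lemma weak_gradient_mollify:
  fixes u :: "'a::euclidean_space \<Rightarrow> real"
  assumes "open G" "has_weak_gradient G u g" "b \<in> Basis" "smooth \<rho>"
    "\<And>z. norm z \<ge> \<epsilon> \<Longrightarrow> \<rho> z = 0" "cball y \<epsilon> \<subseteq> T" "T \<subseteq> G"
  shows "- (LINT x|lebesgue. (if x \<in> T then u x else 0) * frechet_derivative \<rho> (at (x - y)) b)
       = (LINT x|lebesgue. (if x \<in> T then g x \<bullet> b else 0) * \<rho> (x - y))"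
proof -
  interpret C1_compact_support \<rho> "\<lambda>z. frechet_derivative \<rho> (at z)" \<epsilon>
    using assms(4,5) by (rule C1_compact_support_smooth)
  have in_T: "x \<in> T" if "norm (x - y) \<le> \<epsilon>" for x
    using that assms(6) by (auto simp: dist_norm norm_minus_commute)
  have sets: "G \<in> sets lebesgue" using assms(1) by simp
  have "test_function G (\<lambda>x. \<rho> (x - y))"
    by (rule test_functionI[of _ "cball y \<epsilon>"])
       (use assms in \<open>auto intro: smooth_translate simp: dist_norm norm_minus_commute\<close>)
  then have "(LINT x|lebesgue_on G. u x * frechet_derivative (\<lambda>x. \<rho> (x - y)) (at x) b)
      = - (LINT x|lebesgue_on G. (g x \<bullet> b) * \<rho> (x - y))"
    using assms(2,3) unfolding has_weak_gradient_def by blast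
  moreover have "(LINT x|lebesgue_on G. u x * frechet_derivative (\<lambda>x. \<rho> (x - y)) (at x) b)
      = (LINT x|lebesgue. (if x \<in> T then u x else 0) * frechet_derivative \<rho> (at (x - y)) b)"
    using assms(7) in_T supp_D
    by (intro integral_lebesgue_on_extend_zero sets)
       (force simp: frechet_derivative_translate[OF assms(4)] not_le[symmetric])+
  moreover have "(LINT x|lebesgue_on G. (g x \<bullet> b) * \<rho> (x - y))
      = (LINT x|lebesgue. (if x \<in> T then g x \<bullet> b else 0) * \<rho> (x - y))"
    using assms(7) in_T supp
    by (intro integral_lebesgue_on_extend_zero sets) (force simp: not_le[symmetric])+
  ultimately show ?thesis by simp
qed

text \<open>Continuity is local, and the open sets \<open>S\<close> and \<open>- K\<close> cover the
  space.\<close>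

lemma continuous_on_extend_zero:
  fixes f :: "'a::topological_space \<Rightarrow> 'b::real_normed_vector"
  assumes "open S" "closed K" "K \<subseteq> S" "continuous_on S f" "\<And>x. x \<notin> K \<Longrightarrow> f x = 0"
  shows "continuous_on UNIV f"
proof -
  have "continuous_on (- K) f"
    by (rule continuous_on_eq[OF continuous_on_const[of _ 0]]) (use assms(5) in auto)
  then have "continuous_on (S \<union> - K) f"
    using assms by (intro continuous_on_open_Un) auto
  moreover have "S \<union> - K = UNIV" using assms(3) by auto
  ultimately show ?thesis by simp
qed

text \<open>\<open>F (v y) * \<phi> y\<close> is C^1 with compact support, so its derivative
  integrates to 0. The product rule gives the first term and one containing the derivative of
  \<open>v\<close>; on \<open>K\<close> that derivative is the mollified gradient, and Fubini moves
  the mollifier.\<close>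

lemma mollified_chain_rule:
  fixes u :: "'a::euclidean_space \<Rightarrow> real"
  assumes G: "open G" and w: "has_weak_gradient G u g" and b: "b \<in> Basis"
    and \<rho>: "smooth \<rho>" "\<And>z. norm z \<ge> \<epsilon> \<Longrightarrow> \<rho> z = 0"
    and \<phi>: "smooth \<phi>" and K: "compact K" "\<And>x. x \<notin> K \<Longrightarrow> \<phi> x = 0"
    and T: "compact T" "T \<subseteq> G" "\<And>y. y \<in> K \<Longrightarrow> cball y \<epsilon> \<subseteq> T"
    and U_def: "\<And>x. U x = (if x \<in> T then u x else 0)" and U: "integrable lebesgue U"
    and k_def: "\<And>x. k x = (if x \<in> T then g x \<bullet> b else 0)" and k: "integrable lebesgue k"
    and v_def: "v = (\<lambda>y. LINT x|lebesgue. U x * \<rho> (x - y))"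
    and S: "open S" "\<And>y. y \<in> K \<Longrightarrow> v y \<in> S"
    and F: "\<And>s. s \<in> S \<Longrightarrow> (F has_real_derivative F' s) (at s)" "continuous_on S F'"
  shows "(LINT y|lebesgue. F (v y) * frechet_derivative \<phi> (at y) b)
       + (LINT x|lebesgue. k x *
            (LINT y|lebesgue. \<rho> (x - y) * (F' (v y) * \<phi> y))) = 0"
    and "continuous_on UNIV (\<lambda>y. F' (v y) * \<phi> y)"
    and "continuous_on UNIV (\<lambda>y. F (v y) * frechet_derivative \<phi> (at y) b)"
proof -
  interpret \<rho>: C1_compact_support \<rho> "\<lambda>z. frechet_derivative \<rho> (at z)" \<epsilon>
    using \<rho> by (rule C1_compact_support_smooth)
  define Dv where "Dv y w = - (LINT x|lebesgue. U x * frechet_derivative \<rho> (at (x - y)) w)" for y w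
  have v: "(v has_derivative Dv y) (at y)" for y
    unfolding v_def Dv_def by (rule \<rho>.conv_has_derivative[OF U])
  have "smooth v" unfolding v_def by (rule smooth_conv[OF U \<rho>])
  have "frechet_derivative v (at y) = Dv y" for y
    using frechet_derivative_at[OF v] by metis
  then have Dv: "continuous_on UNIV (\<lambda>y. Dv y w)" for w
    using smooth_imp_continuous[OF smooth_derivative[OF \<open>smooth v\<close>, of w]] by simp
  have cv: "continuous_on UNIV v" using \<open>smooth v\<close> by (rule smooth_imp_continuous)
  \<comment> \<open>\<open>F\<close> is differentiable only on \<open>S\<close>, and
    \<open>v\<close> need not take values in \<open>S\<close> off \<open>K\<close>; continuity is
    therefore shown on this open neighbourhood of \<open>K\<close> and extended by zero.\<close>
  define W where "W = v -` S"
  have W: "open W" "K \<subseteq> W"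
    using S open_vimage[OF S(1) cv] by (auto simp: W_def)
  have D\<phi>: "frechet_derivative \<phi> (at x) w = 0" if "x \<notin> K" for x w
    by (rule derivative_zero_off_support[OF smooth_has_derivative[OF \<phi>], of "- K"])
       (use that K in \<open>auto simp: compact_imp_closed open_Compl\<close>)
  have cF: "continuous_on W (\<lambda>y. F (v y))" "continuous_on W (\<lambda>y. F' (v y))"
  proof -
    have "continuous_on S F" using F(1) by (meson DERIV_isCont continuous_at_imp_continuous_on)
    then show "continuous_on W (\<lambda>y. F (v y))"
      by (rule continuous_on_compose2) (auto simp: W_def intro: continuous_on_subset[OF cv])
    show "continuous_on W (\<lambda>y. F' (v y))"
      by (rule continuous_on_compose2[OF F(2)]) (auto simp: W_def intro: continuous_on_subset[OF cv])
  qed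
  have c\<phi>: "continuous_on W \<phi>" "continuous_on W (\<lambda>y. frechet_derivative \<phi> (at y) w)"
    "continuous_on W (\<lambda>y. Dv y w)" for w
    using smooth_imp_continuous[OF \<phi>] smooth_imp_continuous[OF smooth_derivative[OF \<phi>]] Dv
      continuous_on_subset by blast+
  have ext: "continuous_on UNIV f" if "continuous_on W f" "\<And>x. x \<notin> K \<Longrightarrow> f x = 0" for f :: "'a \<Rightarrow> real"
    using continuous_on_extend_zero[OF W(1) compact_imp_closed[OF K(1)] W(2) that] .
  show c1: "continuous_on UNIV (\<lambda>y. F' (v y) * \<phi> y)"
    by (rule ext) (use cF c\<phi> K in \<open>auto intro: continuous_on_mult\<close>)
  have c2: "continuous_on UNIV (\<lambda>y. F (v y) * frechet_derivative \<phi> (at y) w)" for w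
    by (rule ext) (use cF c\<phi> D\<phi> in \<open>auto intro: continuous_on_mult\<close>)
  show "continuous_on UNIV (\<lambda>y. F (v y) * frechet_derivative \<phi> (at y) b)" by (rule c2)
  obtain R where R: "\<And>x. x \<in> K \<Longrightarrow> norm x < R"
    using compact_imp_bounded[OF K(1)] bounded_pos_less by (metis bounded_pos_less)
  interpret P: C1_compact_support "\<lambda>y. F (v y) * \<phi> y"
    "\<lambda>y w. F (v y) * frechet_derivative \<phi> (at y) w + F' (v y) * \<phi> y * Dv y w" R
  proof
    fix z
    show "((\<lambda>y. F (v y) * \<phi> y) has_derivative
        (\<lambda>w. F (v z) * frechet_derivative \<phi> (at z) w + F' (v z) * \<phi> z * Dv z w)) (at z)"
    proof (cases "z \<in> K")
      case True
      have "((\<lambda>y. F (v y)) has_derivative (\<lambda>w. F' (v z) * Dv z w)) (at z)"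
        using has_derivative_compose[OF v F(1)[THEN has_field_derivative_imp_has_derivative], OF S(2)[OF True]] .
      from has_derivative_mult[OF this smooth_has_derivative[OF \<phi>]]
      show ?thesis by (simp add: mult_ac)
    next
      case False
      have "((\<lambda>y. F (v y) * \<phi> y) has_derivative (\<lambda>w. 0)) (at z)"
        by (rule has_derivative_transform_within_open[of "\<lambda>_. 0" _ _ _ "- K"])
           (use False K in \<open>auto simp: compact_imp_closed open_Compl\<close>)
      then show ?thesis using False by (simp add: K D\<phi>)
    qed
  next
    fix w
    show "continuous_on UNIV (\<lambda>z. F (v z) * frechet_derivative \<phi> (at z) w + F' (v z) * \<phi> z * Dv z w)"
      by (intro continuous_on_add continuous_on_mult c1 c2 Dv)
  next
    fix z :: 'a assume "R \<le> norm z"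
    then have "z \<notin> K" using R by force
    then show "F (v z) * \<phi> z = 0" by (simp add: K)
  qed
  have i1: "integrable lebesgue (\<lambda>y. F' (v y) * \<phi> y)"
    by (rule integrable_compact_support[OF K(1)]) (auto intro: continuous_on_subset[OF c1] simp: K)
  have i2: "integrable lebesgue (\<lambda>y. F (v y) * frechet_derivative \<phi> (at y) b)"
    by (rule integrable_compact_support[OF K(1)]) (auto intro: continuous_on_subset[OF c2] simp: D\<phi>)
  have i3: "integrable lebesgue (\<lambda>y. F' (v y) * \<phi> y * Dv y b)"
    by (rule integrable_compact_support[OF K(1)])
       (auto intro!: continuous_on_mult continuous_on_subset[OF c1] continuous_on_subset[OF Dv] simp: K)
  \<comment> \<open>The mollified gradient is available only for \<open>y\<close> in
    \<open>K\<close>; elsewhere the factor \<open>\<phi> y\<close> makes both sides 0.\<close>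
  have "F' (v y) * \<phi> y * Dv y b = F' (v y) * \<phi> y *
      (LINT x|lebesgue. k x * \<rho> (x - y))" for y
    using weak_gradient_mollify[OF G w b \<rho> T(3) T(2)] by (cases "y \<in> K") (simp_all add: Dv_def K(2) U_def k_def)
  then have "(LINT y|lebesgue. F' (v y) * \<phi> y * Dv y b) = (LINT y|lebesgue. F' (v y) * \<phi> y *
      (LINT x|lebesgue. k x * \<rho> (x - y)))"
    by presburger
  also obtain B where B: "\<And>x. \<bar>\<rho> x\<bar> \<le> B" using \<rho>.bounded by blast
  have "(LINT y|lebesgue. F' (v y) * \<phi> y *
      (LINT x|lebesgue. k x * \<rho> (x - y)))
    = (LINT x|lebesgue. k x *
            (LINT y|lebesgue. \<rho> (x - y) * (F' (v y) * \<phi> y)))"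
    by (rule Fubini_convolution(1)[OF k i1 \<rho>.cont B])
  finally show "(LINT y|lebesgue. F (v y) * frechet_derivative \<phi> (at y) b)
       + (LINT x|lebesgue. k x *
            (LINT y|lebesgue. \<rho> (x - y) * (F' (v y) * \<phi> y))) = 0"
    using P.integral_derivative_zero[of b] Bochner_Integration.integral_add[OF i2 i3] by simp
qed

section \<open>Chain rule for weak gradients\<close>

lemma integrable_lebesgue_on_compact:
  fixes f :: "'a::euclidean_space \<Rightarrow> 'b::euclidean_space"
  assumes "compact K" "continuous_on K f"
  shows "integrable (lebesgue_on K) f"
proof -
  have "continuous_on K (\<lambda>x. if x \<in> K then f x else 0)"
    by (rule continuous_on_eq[OF assms(2)]) simp
  then have "integrable lebesgue (\<lambda>x. if x \<in> K then f x else 0)"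
    by (rule integrable_compact_support[OF assms(1)]) simp
  moreover have "K \<in> sets lebesgue" using assms(1) by (simp add: compact_imp_closed)
  ultimately show ?thesis by (simp add: Lebesgue_Measure.integrable_restrict_UNIV)
qed

lemma measurable_lebesgue_on_compact:
  fixes f :: "'a::euclidean_space \<Rightarrow> 'b::euclidean_space"
  assumes "compact K" "continuous_on K f"
  shows "f \<in> borel_measurable (lebesgue_on K)"
  using integrable_lebesgue_on_compact[OF assms] by simp

lemma bounded_on_compact:
  fixes f :: "'a::euclidean_space \<Rightarrow> real"
  assumes "compact K" "continuous_on K f"
  obtains B where "B \<ge> 0" "\<And>x. x \<in> K \<Longrightarrow> \<bar>f x\<bar> \<le> B"
proof -
  have "bounded (f ` K)" using assms by (intro compact_imp_bounded compact_continuous_image)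
  then obtain B where B: "\<forall>x\<in>K. norm (f x) \<le> B" by (auto simp: bounded_iff)
  have "\<bar>f x\<bar> \<le> \<bar>B\<bar>" if "x \<in> K" for x using B that by force
  then show thesis using that[of "\<bar>B\<bar>"] by auto
qed

lemma integrable_scaleR_compact:
  fixes g :: "'a::euclidean_space \<Rightarrow> 'b::euclidean_space"
  assumes "compact K" "continuous_on K f" "integrable (lebesgue_on K) g"
  shows "integrable (lebesgue_on K) (\<lambda>x. f x *\<^sub>R g x)"
proof -
  obtain B where B: "B \<ge> 0" "\<And>x. x \<in> K \<Longrightarrow> \<bar>f x\<bar> \<le> B"
    using bounded_on_compact[OF assms(1,2)] by blast
  show ?thesis
  proof (rule Bochner_Integration.integrable_bound)
    show "integrable (lebesgue_on K) (\<lambda>x. B *\<^sub>R g x)" using assms(3) by simp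
    show "(\<lambda>x. f x *\<^sub>R g x) \<in> borel_measurable (lebesgue_on K)"
      using measurable_lebesgue_on_compact[OF assms(1,2)] assms(3) by measurable
    show "AE x in lebesgue_on K. norm (f x *\<^sub>R g x) \<le> norm (B *\<^sub>R g x)"
      using B by (intro AE_I2) (simp add: mult_right_mono)
  qed
qed

lemma locally_integrable_scaleR:
  "continuous_on G f \<Longrightarrow> locally_integrable G g \<Longrightarrow> locally_integrable G (\<lambda>x. f x *\<^sub>R g x)"
  unfolding locally_integrable_def
  by (auto intro!: integrable_scaleR_compact intro: continuous_on_subset)

lemma locally_integrable_continuous:
  "continuous_on G f \<Longrightarrow> locally_integrable G f"
  unfolding locally_integrable_def
  by (auto intro!: integrable_lebesgue_on_compact intro: continuous_on_subset)

lemma test_function_derivative_zero: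
  assumes "test_function G \<phi>" "x \<notin> closure {x. \<phi> x \<noteq> 0}"
  shows "\<phi> x = 0" "frechet_derivative \<phi> (at x) w = 0"
proof -
  have *: "\<phi> y = 0" if "y \<in> - closure {x. \<phi> x \<noteq> 0}" for y
    using that closure_subset[of "{x. \<phi> x \<noteq> 0}"] by auto
  show "\<phi> x = 0" by (rule *) (use assms(2) in simp)
  have "smooth \<phi>" using assms(1) by (simp add: test_function_def)
  show "frechet_derivative \<phi> (at x) w = 0"
  proof (rule derivative_zero_off_support[OF smooth_has_derivative[OF \<open>smooth \<phi>\<close>]])
    show "open (- closure {x. \<phi> x \<noteq> 0})" by (simp add: open_Compl)
    show "x \<in> - closure {x. \<phi> x \<noteq> 0}" using assms(2) by simp
  qed (rule *)
qed

text \<open>\<open>w\<close> is a probability density, so \<open>c\<close> is its own average and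
  the difference is the average of \<open>f x - c\<close>.\<close>

lemma average_close:
  fixes f w :: "'a::euclidean_space \<Rightarrow> real"
  assumes w: "\<And>x. w x \<ge> 0" "(LINT x|lebesgue. w x) = 1"
    and f: "integrable lebesgue (\<lambda>x. f x * w x)"
    and close: "\<And>x. w x \<noteq> 0 \<Longrightarrow> \<bar>f x - c\<bar> \<le> m"
  shows "\<bar>(LINT x|lebesgue. f x * w x) - c\<bar> \<le> m"
proof -
  \<comment> \<open>A non-integrable function has integral 0 by convention, so the value 1 forces
    integrability.\<close>
  have int: "integrable lebesgue w"
    using w(2) not_integrable_integral_eq by fastforce
  have "(LINT x|lebesgue. f x * w x) - c = (LINT x|lebesgue. f x * w x - c * w x)"
    using f int w(2) by simp
  also have "\<bar>\<dots>\<bar> \<le> (LINT x|lebesgue. m * w x)"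
  proof (rule integral_abs_bound_integral)
    fix x
    have "\<bar>f x * w x - c * w x\<bar> = \<bar>f x - c\<bar> * w x"
      using w(1)[of x] by (simp add: left_diff_distrib[symmetric] abs_mult)
    also have "\<dots> \<le> m * w x"
      using close[of x] w(1)[of x] by (cases "w x = 0") (auto intro: mult_right_mono)
    finally show "\<bar>f x * w x - c * w x\<bar> \<le> m * w x" .
  qed (use f int in auto)
  also have "\<dots> = m" using w(2) by simp
  finally show ?thesis .
qed

text \<open>
  Fubini moves the mollifier from \<open>g\<close> onto the continuous factor \<open>F'(u) \<phi>\<close>, so only uniform
  convergence of mollified continuous functions is needed, and no convergence of mollified gradients.
\<close>

lemma has_weak_gradient_chain:
  fixes u :: "'a::euclidean_space \<Rightarrow> real"
  assumes G: "open G" and cu: "continuous_on G u" and w: "has_weak_gradient G u g"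
    and S: "open S" "\<And>x. x \<in> G \<Longrightarrow> u x \<in> S"
    and F: "\<And>s. s \<in> S \<Longrightarrow> (F has_real_derivative F' s) (at s)" "continuous_on S F'"
  shows "has_weak_gradient G (\<lambda>x. F (u x)) (\<lambda>x. F' (u x) *\<^sub>R g x)"
proof -
  have cF: "continuous_on S F" using F(1) by (meson DERIV_isCont continuous_at_imp_continuous_on)
  have cFu: "continuous_on G (\<lambda>x. F (u x))" "continuous_on G (\<lambda>x. F' (u x))"
    using S(2) by (auto intro!: continuous_on_compose2[OF _ cu, of S] cF F(2))
  have gloc: "locally_integrable G g" using w by (simp add: has_weak_gradient_def)
  have sets: "G \<in> sets lebesgue" using G by simp
  have main: "(LINT x|lebesgue_on G. F (u x) * frechet_derivative \<phi> (at x) b)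
      = - (LINT x|lebesgue_on G. (F' (u x) *\<^sub>R g x \<bullet> b) * \<phi> x)"
    if \<phi>: "test_function G \<phi>" and b: "b \<in> Basis" for \<phi> b
  proof -
    define K where "K = closure {x. \<phi> x \<noteq> 0}"
    have K: "compact K" "K \<subseteq> G" and sm: "smooth \<phi>"
      using \<phi> by (auto simp: test_function_def K_def)
    have \<phi>0: "\<phi> x = 0" "frechet_derivative \<phi> (at x) w = 0" if "x \<notin> K" for x w
      by (rule test_function_derivative_zero[OF \<phi> that[unfolded K_def]])+
    obtain r where r: "r > 0" "(\<Union>x\<in>K. cball x r) \<subseteq> G"
      using compact_subset_open_imp_cball_epsilon_subset[OF K(1) G K(2)] .
    define T where "T = (\<Union>x\<in>K. cball x r)"
    have T: "compact T" "T \<subseteq> G" using compact_minkowski_sum_cball[OF K(1)] r by (auto simp: T_def)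
    have KT: "K \<subseteq> T" using r(1) by (auto simp: T_def)
    have setsT: "T \<in> sets lebesgue" using T(1) by (simp add: compact_imp_closed)
    define k where "k x = (if x \<in> T then g x \<bullet> b else 0)" for x
    define U where "U x = (if x \<in> T then u x else 0)" for x
    define d\<phi> where "d\<phi> x = frechet_derivative \<phi> (at x) b" for x
    define \<theta> where "\<theta> x = (if x \<in> K then F' (u x) * \<phi> x else 0)" for x
    define Fu where "Fu x = (if x \<in> K then F (u x) * d\<phi> x else 0)" for x
    have k: "integrable lebesgue k"
      using gloc T setsT
      by (auto simp: k_def[abs_def] Lebesgue_Measure.integrable_restrict_UNIV locally_integrable_def)
    have U: "integrable lebesgue U"
      using T setsT integrable_lebesgue_on_compact[OF T(1) continuous_on_subset[OF cu T(2)]]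
      by (simp add: U_def[abs_def] Lebesgue_Measure.integrable_restrict_UNIV)
    have c\<phi>: "continuous_on A \<phi>" "continuous_on A d\<phi>" for A
      using smooth_imp_continuous[OF sm] smooth_imp_continuous[OF smooth_derivative[OF sm]]
      by (auto simp: d\<phi>_def intro: continuous_on_subset)
    have c\<theta>: "continuous_on UNIV \<theta>"
    proof (rule continuous_on_extend_zero[OF G compact_imp_closed[OF K(1)] K(2)])
      show "continuous_on G \<theta>"
        by (rule continuous_on_eq[OF continuous_on_mult[OF cFu(2) c\<phi>(1)]]) (auto simp: \<theta>_def \<phi>0)
    qed (simp add: \<theta>_def)
    have cFu': "continuous_on UNIV Fu"
    proof (rule continuous_on_extend_zero[OF G compact_imp_closed[OF K(1)] K(2)])
      show "continuous_on G Fu"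
        by (rule continuous_on_eq[OF continuous_on_mult[OF cFu(1) c\<phi>(2)]]) (auto simp: Fu_def d\<phi>_def \<phi>0)
    qed (simp add: Fu_def)
    have iFu: "integrable lebesgue Fu"
      by (rule integrable_compact_support[OF K(1) continuous_on_subset[OF cFu' subset_UNIV]]) (simp add: Fu_def)
    have id\<phi>: "integrable lebesgue d\<phi>"
      by (rule integrable_compact_support[OF K(1) c\<phi>(2)]) (simp add: d\<phi>_def \<phi>0)
    obtain B\<theta> where B\<theta>: "\<And>x. \<bar>\<theta> x\<bar> \<le> B\<theta>"
      by (rule bounded_compact_support[OF K(1) continuous_on_subset[OF c\<theta> subset_UNIV]]) (auto simp: \<theta>_def)
    obtain M where M: "M \<ge> 0" "\<And>x. \<bar>\<phi> x\<bar> \<le> M"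
      using bounded_compact_support[OF K(1) c\<phi>(1) \<phi>0(1)] by blast
    have ik\<theta>: "integrable lebesgue (\<lambda>x. k x * \<theta> x)"
      by (rule integrable_mult_bounded[OF k borel_measurable_continuous_lebesgue[OF c\<theta>] B\<theta>])
    \<comment> \<open>\<open>A\<close> is the defect in the weak gradient identity for
      \<open>F (u x)\<close>; it is shown to be at most \<open>e * C\<close> for every
      \<open>e > 0\<close>.\<close>
    define A where "A = (LINT x|lebesgue. Fu x) + (LINT x|lebesgue. k x * \<theta> x)"
    \<comment> \<open>The first summand pays for replacing \<open>F (u y)\<close> by
      \<open>F (v y)\<close>, the second for replacing \<open>\<theta>\<close> by
      \<open>k'\<close>.\<close>
    define C where "C = (LINT x|lebesgue. \<bar>d\<phi> x\<bar>) + (M + 1) * (LINT x|lebesgue. \<bar>k x\<bar>)"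
    have C: "C \<ge> 0" using M(1) by (auto simp: C_def)
    have est: "\<bar>A\<bar> \<le> e * C" if e: "e > 0" for e
    proof -
      have uK: "compact (u ` K)" "u ` K \<subseteq> S"
        using K S(2) by (auto intro!: compact_continuous_image continuous_on_subset[OF cu])
      obtain d1 where d1: "d1 > 0"
        "\<And>s t. s \<in> u ` K \<Longrightarrow> dist s t \<le> d1 \<Longrightarrow> t \<in> S \<and> dist (F s) (F t) < e"
        using compact_uniform_neighbourhood[OF S(1) uK cF e] by blast
      obtain d2 where d2: "d2 > 0"
        "\<And>s t. s \<in> u ` K \<Longrightarrow> dist s t \<le> d2 \<Longrightarrow> t \<in> S \<and> dist (F' s) (F' t) < e"
        using compact_uniform_neighbourhood[OF S(1) uK F(2) e] by blast
      define m where "m = min d1 d2"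
      have m: "m > 0" using d1(1) d2(1) by (simp add: m_def)
      obtain d3 where d3: "d3 > 0"
        "\<And>s t. s \<in> K \<Longrightarrow> dist s t \<le> d3 \<Longrightarrow> t \<in> G \<and> dist (u s) (u t) < m"
        using compact_uniform_neighbourhood[OF G K cu m] by blast
      obtain d4 where d4: "d4 > 0" "\<And>s t. s \<in> T \<Longrightarrow> dist s t \<le> d4 \<Longrightarrow> dist (\<theta> s) (\<theta> t) < e"
        using compact_uniform_neighbourhood[OF open_UNIV T(1) subset_UNIV c\<theta> e] by metis
      \<comment> \<open>\<open>r\<close> keeps balls around points of \<open>K\<close> inside
        \<open>T\<close>, \<open>d3\<close> keeps \<open>v\<close> close to \<open>u\<close> on
        \<open>K\<close>, and \<open>d4\<close> controls the oscillation of \<open>\<theta>\<close>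
        around points of \<open>T\<close>.\<close>
      define \<epsilon> where "\<epsilon> = min r (min d3 d4)"
      have \<epsilon>: "\<epsilon> > 0" "\<epsilon> \<le> r" "\<epsilon> \<le> d3" "\<epsilon> \<le> d4" using r d3 d4 by (auto simp: \<epsilon>_def)
      obtain \<rho> :: "'a \<Rightarrow> real" where \<rho>: "smooth \<rho>" "\<And>x. \<rho> x \<ge> 0" "\<And>x. norm x \<ge> \<epsilon> \<Longrightarrow> \<rho> x = 0"
        "(LINT x|lebesgue. \<rho> x) = 1"
        using mollifier_exists[OF \<epsilon>(1)] by metis
      have c\<rho>: "continuous_on UNIV \<rho>" using \<rho>(1) by (rule smooth_imp_continuous)
      have \<rho>1: "(LINT x|lebesgue. \<rho> (x - y)) = 1" "(LINT x|lebesgue. \<rho> (y - x)) = 1" for y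
        using lebesgue_integral_reflect_translate[OF c\<rho>] \<rho>(4) by simp_all
      have cbT: "cball y \<epsilon> \<subseteq> T" if "y \<in> K" for y
      proof -
        have "cball y \<epsilon> \<subseteq> cball y r" using \<epsilon>(2) by (simp add: subset_cball)
        also have "\<dots> \<subseteq> T" using that by (auto simp: T_def)
        finally show ?thesis .
      qed
      define v where "v = (\<lambda>y. LINT x|lebesgue. U x * \<rho> (x - y))"
      interpret \<rho>: C1_compact_support \<rho> "\<lambda>z. frechet_derivative \<rho> (at z)" \<epsilon>
        using \<rho>(1,3) by (rule C1_compact_support_smooth)
      have v: "dist (u y) (v y) \<le> m" if y: "y \<in> K" for y
      proof -
        have "\<bar>(LINT x|lebesgue. U x * \<rho> (x - y)) - u y\<bar> \<le> m"
        proof (rule average_close[where w = "\<lambda>x. \<rho> (x - y)"])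
          fix x assume "\<rho> (x - y) \<noteq> 0"
          then have x: "dist y x < \<epsilon>"
            using \<rho>(3)[of "x - y"] by (force simp: dist_norm norm_minus_commute)
          then have "x \<in> T" using cbT[OF y] by auto
          then show "\<bar>U x - u y\<bar> \<le> m"
            using d3(2)[OF y, of x] x \<epsilon>(3) by (auto simp: U_def dist_real_def)
        qed (use \<rho>.integrable_conv(1)[OF U] \<rho>(2) \<rho>1(1) in auto)
        then show ?thesis by (simp add: v_def dist_real_def abs_minus_commute)
      qed
      have vS: "v y \<in> S" "\<bar>F (v y) - F (u y)\<bar> \<le> e" "\<bar>F' (v y) - F' (u y)\<bar> \<le> e" if y: "y \<in> K" for y
        using d1(2)[of "u y" "v y"] d2(2)[of "u y" "v y"] v[OF y] y
        by (auto simp: m_def dist_real_def abs_minus_commute)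
      define \<theta>' where "\<theta>' y = F' (v y) * \<phi> y" for y
      define k' where "k' x = (LINT y|lebesgue. \<rho> (x - y) * \<theta>' y)" for x
      have eq: "(LINT y|lebesgue. F (v y) * d\<phi> y) + (LINT x|lebesgue. k x * k' x) = 0"
        unfolding d\<phi>_def k'_def \<theta>'_def
        by (rule mollified_chain_rule(1)[where u = u and G = G and g = g and \<epsilon> = \<epsilon> and K = K and T = T
              and U = U and S = S]; fact)
      have c\<theta>': "continuous_on UNIV \<theta>'"
        unfolding \<theta>'_def[abs_def]
        by (rule mollified_chain_rule(2)[where u = u and G = G and g = g and \<epsilon> = \<epsilon> and K = K and T = T
              and U = U and S = S and \<rho> = \<rho> and b = b and k = k and F = F]; fact)
      have cFv: "continuous_on UNIV (\<lambda>y. F (v y) * d\<phi> y)"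
        unfolding d\<phi>_def
        by (rule mollified_chain_rule(3)[where u = u and G = G and g = g and \<epsilon> = \<epsilon> and K = K and T = T
              and U = U and S = S and \<rho> = \<rho> and k = k and F' = F']; fact)
      have i\<theta>': "integrable lebesgue \<theta>'"
        by (rule integrable_compact_support[OF K(1) continuous_on_subset[OF c\<theta>' subset_UNIV]]) (simp add: \<theta>'_def \<phi>0)
      have iFv: "integrable lebesgue (\<lambda>y. F (v y) * d\<phi> y)"
        by (rule integrable_compact_support[OF K(1) continuous_on_subset[OF cFv subset_UNIV]]) (simp add: d\<phi>_def \<phi>0)
      have \<theta>'\<theta>: "\<bar>\<theta>' y - \<theta> y\<bar> \<le> e * M" for y
      proof (cases "y \<in> K")
        case True
        then have "\<theta>' y - \<theta> y = (F' (v y) - F' (u y)) * \<phi> y"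
          by (simp add: \<theta>'_def \<theta>_def left_diff_distrib)
        then show ?thesis using mult_mono[OF vS(3)[OF True] M(2)[of y]] e by (simp add: abs_mult)
      qed (use e M in \<open>simp add: \<theta>'_def \<theta>_def \<phi>0\<close>)
      \<comment> \<open>The share \<open>e * M\<close> comes from replacing \<open>\<theta>'\<close>
        by \<open>\<theta>\<close>, and one more \<open>e\<close> from averaging
        \<open>\<theta>\<close> against the mollifier.\<close>
      have k'\<theta>: "\<bar>k' x - \<theta> x\<bar> \<le> e * (M + 1)" if x: "x \<in> T" for x
      proof -
        have "\<bar>(LINT y|lebesgue. \<theta>' y * \<rho> (x - y)) - \<theta> x\<bar> \<le> e * (M + 1)"
        proof (rule average_close[where w = "\<lambda>y. \<rho> (x - y)"])
          obtain B where B: "\<And>x. \<bar>\<rho> x\<bar> \<le> B" using \<rho>.bounded by blast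
          have "continuous_on UNIV (\<lambda>y. \<rho> (x - y))"
            by (rule continuous_on_compose2[OF c\<rho>]) (auto intro!: continuous_intros)
          from integrable_mult_bounded[OF i\<theta>' borel_measurable_continuous_lebesgue[OF this] B]
          show "integrable lebesgue (\<lambda>y. \<theta>' y * \<rho> (x - y))" .
          fix y assume "\<rho> (x - y) \<noteq> 0"
          then have "dist x y \<le> \<epsilon>"
            using \<rho>(3)[of "x - y"] by (force simp: dist_norm)
          then have "\<bar>\<theta> y - \<theta> x\<bar> < e"
            using d4(2)[OF x, of y] \<epsilon>(4) by (simp add: dist_real_def abs_minus_commute)
          then show "\<bar>\<theta>' y - \<theta> x\<bar> \<le> e * (M + 1)"
            using \<theta>'\<theta>[of y] by (simp add: distrib_left)
        qed (rule \<rho>(2) \<rho>1(2))+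
        then show ?thesis by (simp add: k'_def mult.commute)
      qed
      have e1: "\<bar>LINT y|lebesgue. (Fu y - F (v y) * d\<phi> y)\<bar> \<le> (LINT y|lebesgue. e * \<bar>d\<phi> y\<bar>)"
      proof (rule integral_abs_bound_integral)
        fix y
        show "\<bar>Fu y - F (v y) * d\<phi> y\<bar> \<le> e * \<bar>d\<phi> y\<bar>"
        proof (cases "y \<in> K")
          case True
          then have "Fu y - F (v y) * d\<phi> y = (F (u y) - F (v y)) * d\<phi> y"
            by (simp add: Fu_def left_diff_distrib)
          then show ?thesis
            using mult_right_mono[OF vS(2)[OF True], of "\<bar>d\<phi> y\<bar>"] by (simp add: abs_mult abs_minus_commute)
        qed (simp add: Fu_def d\<phi>_def \<phi>0)
      qed (use iFu iFv id\<phi> in auto)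
      have kk': "\<bar>k x * (\<theta> x - k' x)\<bar> \<le> e * (M + 1) * \<bar>k x\<bar>" for x
      proof (cases "x \<in> T")
        case True
        then show ?thesis
          using mult_left_mono[OF k'\<theta>[OF True], of "\<bar>k x\<bar>"] by (simp add: abs_mult abs_minus_commute mult_ac)
      qed (simp add: k_def)
      have ikk': "integrable lebesgue (\<lambda>x. k x * k' x)"
      proof -
        obtain B where "\<And>x. \<bar>\<rho> x\<bar> \<le> B" using \<rho>.bounded by blast
        from Fubini_convolution(2)[OF k i\<theta>' c\<rho> this] show ?thesis by (simp add: k'_def)
      qed
      have e2: "\<bar>LINT x|lebesgue. k x * \<theta> x - k x * k' x\<bar> \<le> (LINT x|lebesgue. e * (M + 1) * \<bar>k x\<bar>)"
        by (rule integral_abs_bound_integral) (use ik\<theta> ikk' k kk' in \<open>auto simp: right_diff_distrib\<close>)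
      have "A = (LINT y|lebesgue. (Fu y - F (v y) * d\<phi> y)) + (LINT x|lebesgue. k x * \<theta> x - k x * k' x)"
        using iFu iFv ik\<theta> ikk' eq by (simp add: A_def)
      also have "\<bar>\<dots>\<bar> \<le> (LINT y|lebesgue. e * \<bar>d\<phi> y\<bar>) + (LINT x|lebesgue. e * (M + 1) * \<bar>k x\<bar>)"
        using e1 e2 by linarith
      also have "\<dots> = e * C"
        by (simp only: C_def integral_mult_right_zero) (simp add: algebra_simps)
      finally show ?thesis .
    qed
    have "A = 0"
    proof (rule ccontr)
      assume "A \<noteq> 0"
      \<comment> \<open>With this choice of \<open>e\<close> the estimate bounds
        \<open>\<bar>A\<bar>\<close> by half of itself.\<close>
      then have "\<bar>A\<bar> / (2 * (C + 1)) > 0" using C by simp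
      from est[OF this] have "\<bar>A\<bar> \<le> \<bar>A\<bar> / 2 * (C / (C + 1))" by (simp add: field_simps)
      also have "\<dots> \<le> \<bar>A\<bar> / 2 * 1" using C by (intro mult_left_mono) auto
      finally show False using \<open>A \<noteq> 0\<close> by simp
    qed
    moreover have "(LINT x|lebesgue_on G. F (u x) * frechet_derivative \<phi> (at x) b) = (LINT x|lebesgue. Fu x)"
      using K(2) by (intro integral_lebesgue_on_extend_zero sets) (auto simp: Fu_def d\<phi>_def \<phi>0)
    moreover have "(LINT x|lebesgue_on G. (F' (u x) *\<^sub>R g x \<bullet> b) * \<phi> x) = (LINT x|lebesgue. k x * \<theta> x)"
      using K(2) T(2) KT by (intro integral_lebesgue_on_extend_zero sets) (auto simp: k_def \<theta>_def \<phi>0)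
    ultimately show ?thesis by (simp add: A_def)
  qed
  show ?thesis
    unfolding has_weak_gradient_def
    by (intro conjI allI impI ballI locally_integrable_continuous[OF cFu(1)]
        locally_integrable_scaleR[OF cFu(2) gloc] main)
qed

section \<open>Calculus of continuous local Sobolev functions\<close>

lemma integrable_lebesgue_on_subset:
  fixes f :: "'a::euclidean_space \<Rightarrow> 'b::euclidean_space"
  assumes "integrable lebesgue f" "S \<in> sets lebesgue"
  shows "integrable (lebesgue_on S) f"
  using integrable_mult_indicator[OF assms(2,1)] assms(2)
  by (simp add: integrable_restrict_space)

lemma integrable_extend_zero:
  fixes f :: "'a::euclidean_space \<Rightarrow> 'b::euclidean_space"
  assumes "integrable (lebesgue_on K) f" "K \<in> sets lebesgue" "\<And>x. x \<notin> K \<Longrightarrow> f x = 0"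
  shows "integrable lebesgue f"
proof -
  have "(\<lambda>x. if x \<in> K then f x else 0) = f" using assms(3) by auto
  then show ?thesis
    using Lebesgue_Measure.integrable_restrict_UNIV[OF assms(2), of f] assms(1) by simp
qed

lemma compact_sets_lebesgue: "compact K \<Longrightarrow> K \<in> sets lebesgue"
  by (simp add: compact_imp_closed)

lemma L2_imp_measurable: "L2 S f \<Longrightarrow> f \<in> borel_measurable (lebesgue_on S)"
  by (simp add: L2_def)

lemma L2_extend_zero:
  fixes f :: "'a::euclidean_space \<Rightarrow> 'b::euclidean_space"
  assumes "L2 K f" "K \<in> sets lebesgue" "\<And>x. x \<notin> K \<Longrightarrow> f x = 0" "S \<in> sets lebesgue"
  shows "L2 S f"
proof -
  have "(\<lambda>x. if x \<in> K then f x else 0) = f" using assms(3) by auto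
  then have "f \<in> borel_measurable lebesgue"
    using borel_measurable_if[OF assms(2), of f] assms(1) by (simp add: L2_def)
  then have "f \<in> borel_measurable (lebesgue_on S)" by (rule measurable_restrict_space1)
  moreover have "integrable lebesgue (\<lambda>x. (norm (f x))\<^sup>2)"
    using assms by (intro integrable_extend_zero[of K]) (auto simp: L2_def)
  ultimately show ?thesis
    using integrable_lebesgue_on_subset[OF _ assms(4)] by (simp add: L2_def)
qed

lemma L2_scaleR:
  fixes g :: "'a::euclidean_space \<Rightarrow> 'b::euclidean_space"
  assumes "compact K" "continuous_on K f" "L2 K g"
  shows "L2 K (\<lambda>x. f x *\<^sub>R g x)"
proof -
  have "integrable (lebesgue_on K) (\<lambda>x. (f x)\<^sup>2 *\<^sub>R (norm (g x))\<^sup>2)"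
    using assms by (intro integrable_scaleR_compact continuous_on_power) (auto simp: L2_def)
  moreover have "(\<lambda>x. f x *\<^sub>R g x) \<in> borel_measurable (lebesgue_on K)"
    using measurable_lebesgue_on_compact[OF assms(1,2)] L2_imp_measurable[OF assms(3)] by measurable
  ultimately show ?thesis by (simp add: L2_def power_mult_distrib)
qed

lemma L2_add:
  fixes f g :: "'a::euclidean_space \<Rightarrow> 'b::euclidean_space"
  assumes "L2 S f" "L2 S g"
  shows "L2 S (\<lambda>x. f x + g x)"
proof -
  have m: "(\<lambda>x. f x + g x) \<in> borel_measurable (lebesgue_on S)"
    using assms[THEN L2_imp_measurable] by measurable
  have "integrable (lebesgue_on S) (\<lambda>x. (norm (f x + g x))\<^sup>2)"
  proof (rule Bochner_Integration.integrable_bound)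
    show "integrable (lebesgue_on S) (\<lambda>x. 2 * (norm (f x))\<^sup>2 + 2 * (norm (g x))\<^sup>2)"
      using assms by (simp add: L2_def)
    show "AE x in lebesgue_on S. norm ((norm (f x + g x))\<^sup>2) \<le> norm (2 * (norm (f x))\<^sup>2 + 2 * (norm (g x))\<^sup>2)"
    proof (rule AE_I2)
      fix x
      have "(norm (f x + g x))\<^sup>2 \<le> (norm (f x) + norm (g x))\<^sup>2"
        by (intro power_mono norm_triangle_ineq) auto
      also have "\<dots> \<le> 2 * (norm (f x))\<^sup>2 + 2 * (norm (g x))\<^sup>2"
        using sum_squares_bound[of "norm (f x)" "norm (g x)"] by (simp add: power2_sum)
      finally show "norm ((norm (f x + g x))\<^sup>2) \<le> norm (2 * (norm (f x))\<^sup>2 + 2 * (norm (g x))\<^sup>2)"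
        by simp
    qed
  qed (use m in measurable)
  then show ?thesis using m by (simp add: L2_def)
qed

lemma L2_continuous:
  fixes f :: "'a::euclidean_space \<Rightarrow> 'b::euclidean_space"
  assumes "compact K" "continuous_on K f"
  shows "L2 K f"
  using assms unfolding L2_def
  by (auto intro!: measurable_lebesgue_on_compact integrable_lebesgue_on_compact continuous_intros)

lemma L2_imp_integrable_inner:
  fixes f g :: "'a::euclidean_space \<Rightarrow> 'b::euclidean_space"
  assumes "L2 S f" "L2 S g"
  shows "integrable (lebesgue_on S) (\<lambda>x. f x \<bullet> g x)"
proof (rule Bochner_Integration.integrable_bound)
  show "integrable (lebesgue_on S) (\<lambda>x. (norm (f x))\<^sup>2 + (norm (g x))\<^sup>2)"
    using assms by (simp add: L2_def)
  show "(\<lambda>x. f x \<bullet> g x) \<in> borel_measurable (lebesgue_on S)"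
    using assms[THEN L2_imp_measurable] by measurable
  show "AE x in lebesgue_on S. norm (f x \<bullet> g x) \<le> norm ((norm (f x))\<^sup>2 + (norm (g x))\<^sup>2)"
  proof (rule AE_I2)
    fix x
    have "\<bar>f x \<bullet> g x\<bar> \<le> norm (f x) * norm (g x)" by (rule Cauchy_Schwarz_ineq2)
    also have "\<dots> \<le> (norm (f x))\<^sup>2 + (norm (g x))\<^sup>2"
      using sum_squares_bound[of "norm (f x)" "norm (g x)"]
        mult_nonneg_nonneg[OF norm_ge_zero norm_ge_zero, of "f x" "g x"]
      unfolding mult.assoc by linarith
    finally show "norm (f x \<bullet> g x) \<le> norm ((norm (f x))\<^sup>2 + (norm (g x))\<^sup>2)" by simp
  qed
qed

lemma integrable_times_compact_support:
  fixes u :: "'a::euclidean_space \<Rightarrow> real"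
  assumes "locally_integrable G u" "G \<in> sets lebesgue" "compact K" "K \<subseteq> G"
    "continuous_on UNIV f" "\<And>x. x \<notin> K \<Longrightarrow> f x = 0"
  shows "integrable (lebesgue_on G) (\<lambda>x. u x * f x)"
proof (rule integrable_lebesgue_on_subset[OF _ assms(2)])
  have "integrable (lebesgue_on K) (\<lambda>x. f x *\<^sub>R u x)"
    using assms by (intro integrable_scaleR_compact) (auto simp: locally_integrable_def intro: continuous_on_subset)
  then show "integrable lebesgue (\<lambda>x. u x * f x)"
    using assms by (intro integrable_extend_zero[OF _ compact_sets_lebesgue[of K]]) (auto simp: mult.commute)
qed

lemma integrable_times_test_function:
  fixes u :: "'a::euclidean_space \<Rightarrow> real"
  assumes "locally_integrable G u" "G \<in> sets lebesgue" "test_function G \<phi>"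
  shows "integrable (lebesgue_on G) (\<lambda>x. u x * \<phi> x)"
    and "integrable (lebesgue_on G) (\<lambda>x. u x * frechet_derivative \<phi> (at x) b)"
proof -
  let ?K = "closure {x. \<phi> x \<noteq> 0}"
  have K: "compact ?K" "?K \<subseteq> G" "smooth \<phi>" using assms(3) by (auto simp: test_function_def)
  show "integrable (lebesgue_on G) (\<lambda>x. u x * \<phi> x)"
    by (rule integrable_times_compact_support[OF assms(1,2) K(1,2) smooth_imp_continuous[OF K(3)]
          test_function_derivative_zero(1)[OF assms(3)]])
  show "integrable (lebesgue_on G) (\<lambda>x. u x * frechet_derivative \<phi> (at x) b)"
    by (rule integrable_times_compact_support[OF assms(1,2) K(1,2)
          smooth_imp_continuous[OF smooth_derivative[OF K(3)]] test_function_derivative_zero(2)[OF assms(3)]])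
qed

text \<open>Continuity already bounds \<open>u\<close> on compact sets, so square integrability is
  demanded of the gradient only. The same bound keeps gradients of products and compositions in
  L^2_loc.\<close>

definition cont_H1_loc :: "'a::euclidean_space set \<Rightarrow> ('a \<Rightarrow> real) \<Rightarrow> ('a \<Rightarrow> 'a) \<Rightarrow> bool" where
  "cont_H1_loc G u g \<longleftrightarrow> open G \<and> continuous_on G u \<and> has_weak_gradient G u g \<and> L2_loc G g"

lemma locally_integrable_inner:
  assumes "locally_integrable G g"
  shows "locally_integrable G (\<lambda>x. g x \<bullet> b)"
  using assms by (auto simp: locally_integrable_def)

lemma cont_H1_loc_add:
  assumes "cont_H1_loc G u g" "cont_H1_loc G v k"
  shows "cont_H1_loc G (\<lambda>x. u x + v x) (\<lambda>x. g x + k x)"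
proof -
  have w: "has_weak_gradient G u g" "has_weak_gradient G v k" and G: "G \<in> sets lebesgue"
    using assms by (auto simp: cont_H1_loc_def)
  have li: "locally_integrable G u" "locally_integrable G g" "locally_integrable G v" "locally_integrable G k"
    using w by (auto simp: has_weak_gradient_def)
  have "has_weak_gradient G (\<lambda>x. u x + v x) (\<lambda>x. g x + k x)"
    unfolding has_weak_gradient_def
  proof (intro conjI allI impI ballI)
    show "locally_integrable G (\<lambda>x. u x + v x)" "locally_integrable G (\<lambda>x. g x + k x)"
      using li by (auto simp: locally_integrable_def)
    fix \<phi> and b :: 'a assume \<phi>: "test_function G \<phi>" and b: "b \<in> Basis"
    note int = integrable_times_test_function[OF _ G \<phi>]
    have "(LINT x|lebesgue_on G. u x * frechet_derivative \<phi> (at x) b) = - (LINT x|lebesgue_on G. (g x \<bullet> b) * \<phi> x)"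
      "(LINT x|lebesgue_on G. v x * frechet_derivative \<phi> (at x) b) = - (LINT x|lebesgue_on G. (k x \<bullet> b) * \<phi> x)"
      using w \<phi> b by (auto simp: has_weak_gradient_def)
    then show "(LINT x|lebesgue_on G. (u x + v x) * frechet_derivative \<phi> (at x) b)
        = - (LINT x|lebesgue_on G. ((g x + k x) \<bullet> b) * \<phi> x)"
      using int(2)[OF li(1), of b] int(2)[OF li(3), of b] int(1)[OF locally_integrable_inner[OF li(2)], of b]
        int(1)[OF locally_integrable_inner[OF li(4)], of b]
      by (simp add: distrib_right inner_add_left)
  qed
  then show ?thesis
    using assms by (auto simp: cont_H1_loc_def L2_loc_def intro: continuous_on_add L2_add)
qed

lemma cont_H1_loc_chain:
  assumes u: "cont_H1_loc G u g" and S: "open S" "\<And>x. x \<in> G \<Longrightarrow> u x \<in> S"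
    and F: "\<And>s. s \<in> S \<Longrightarrow> (F has_real_derivative F' s) (at s)" "continuous_on S F'"
  shows "cont_H1_loc G (\<lambda>x. F (u x)) (\<lambda>x. F' (u x) *\<^sub>R g x)"
proof -
  have G: "open G" and cu: "continuous_on G u" and w: "has_weak_gradient G u g" and L: "L2_loc G g"
    using u by (auto simp: cont_H1_loc_def)
  have "continuous_on S F" using F(1) by (meson DERIV_isCont continuous_at_imp_continuous_on)
  then have cFu: "continuous_on G (\<lambda>x. F (u x))" "continuous_on G (\<lambda>x. F' (u x))"
    using S(2) by (auto intro!: continuous_on_compose2[OF _ cu, of S] F(2))
  have "L2_loc G (\<lambda>x. F' (u x) *\<^sub>R g x)"
    using L cFu(2) by (auto simp: L2_loc_def intro!: L2_scaleR intro: continuous_on_subset)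
  then show ?thesis
    using has_weak_gradient_chain[OF G cu w S F] G cFu by (simp add: cont_H1_loc_def)
qed

lemma cont_H1_loc_scale: "cont_H1_loc G u g \<Longrightarrow> cont_H1_loc G (\<lambda>x. c * u x) (\<lambda>x. c *\<^sub>R g x)"
  using cont_H1_loc_chain[of G u g UNIV "\<lambda>s. c * s" "\<lambda>_. c"]
  by (auto intro: derivative_eq_intros)

lemma cont_H1_loc_square: "cont_H1_loc G u g \<Longrightarrow> cont_H1_loc G (\<lambda>x. (u x)\<^sup>2) (\<lambda>x. (2 * u x) *\<^sub>R g x)"
  by (rule cont_H1_loc_chain[of G u g UNIV "\<lambda>s. s\<^sup>2" "\<lambda>s. 2 * s"])
     (auto intro!: derivative_eq_intros continuous_intros)

text \<open>Polarization: \<open>u v\<close> is half of \<open>(u + v)^2 - u^2 - v^2\<close>, so the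
  chain rule in one variable suffices.\<close>

lemma cont_H1_loc_mult:
  assumes "cont_H1_loc G u g" "cont_H1_loc G v k"
  shows "cont_H1_loc G (\<lambda>x. u x * v x) (\<lambda>x. u x *\<^sub>R k x + v x *\<^sub>R g x)"
proof -
  have "cont_H1_loc G (\<lambda>x. (1/2) * ((u x + v x)\<^sup>2 + ((-1) * (u x)\<^sup>2 + (-1) * (v x)\<^sup>2)))
      (\<lambda>x. (1/2) *\<^sub>R ((2 * (u x + v x)) *\<^sub>R (g x + k x)
          + ((-1) *\<^sub>R ((2 * u x) *\<^sub>R g x) + (-1) *\<^sub>R ((2 * v x) *\<^sub>R k x))))"
    by (intro cont_H1_loc_scale cont_H1_loc_add cont_H1_loc_square assms)
  moreover have "(1/2) * ((u x + v x)\<^sup>2 + ((-1) * (u x)\<^sup>2 + (-1) * (v x)\<^sup>2)) = u x * v x" for x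
    by (simp add: power2_sum)
  moreover have "(1/2) *\<^sub>R ((2 * (u x + v x)) *\<^sub>R (g x + k x)
          + ((-1) *\<^sub>R ((2 * u x) *\<^sub>R g x) + (-1) *\<^sub>R ((2 * v x) *\<^sub>R k x)))
      = u x *\<^sub>R k x + v x *\<^sub>R g x" for x
    by (simp add: algebra_simps)
  ultimately show ?thesis by simp
qed

lemma cont_H1_loc_inverse:
  assumes "cont_H1_loc G u g" "\<And>x. x \<in> G \<Longrightarrow> u x > 0"
  shows "cont_H1_loc G (\<lambda>x. inverse (u x)) (\<lambda>x. (- inverse ((u x)\<^sup>2)) *\<^sub>R g x)"
  by (rule cont_H1_loc_chain[where S = "{0<..}"])
     (use assms in \<open>auto intro!: derivative_eq_intros continuous_intros simp: power2_eq_square\<close>)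

text \<open>This permits redefining test functions as 0 off a compact set, including points off
  \<open>G\<close> where their formulas are uncontrolled.\<close>

lemma cont_H1_loc_cong:
  assumes "cont_H1_loc G u g" "\<And>x. x \<in> G \<Longrightarrow> u' x = u x" "\<And>x. x \<in> G \<Longrightarrow> g' x = g x"
  shows "cont_H1_loc G u' g'"
proof -
  have eq: "integrable (lebesgue_on K) u' = integrable (lebesgue_on K) u"
    "integrable (lebesgue_on K) g' = integrable (lebesgue_on K) g"
    "L2 K g' = L2 K g" if "K \<subseteq> G" for K
    unfolding L2_def using that assms(2,3)
    by (auto intro!: Bochner_Integration.integrable_cong measurable_cong arg_cong2[of _ _ _ _ "(\<and>)"] simp: subset_iff)
  have "has_weak_gradient G u' g'"
    unfolding has_weak_gradient_def
  proof (intro conjI allI impI ballI)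
    show "locally_integrable G u'" "locally_integrable G g'"
      using assms(1) eq by (auto simp: cont_H1_loc_def has_weak_gradient_def locally_integrable_def)
    fix \<phi> and b :: 'a assume "test_function G \<phi>" "b \<in> Basis"
    then have "(LINT x|lebesgue_on G. u x * frechet_derivative \<phi> (at x) b) = - (LINT x|lebesgue_on G. (g x \<bullet> b) * \<phi> x)"
      using assms(1) by (auto simp: cont_H1_loc_def has_weak_gradient_def)
    moreover have "(LINT x|lebesgue_on G. u' x * frechet_derivative \<phi> (at x) b)
        = (LINT x|lebesgue_on G. u x * frechet_derivative \<phi> (at x) b)"
      "(LINT x|lebesgue_on G. (g' x \<bullet> b) * \<phi> x) = (LINT x|lebesgue_on G. (g x \<bullet> b) * \<phi> x)"
      using assms(2,3) by (auto intro!: Bochner_Integration.integral_cong)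
    ultimately show "(LINT x|lebesgue_on G. u' x * frechet_derivative \<phi> (at x) b)
        = - (LINT x|lebesgue_on G. (g' x \<bullet> b) * \<phi> x)" by simp
  qed
  moreover have "continuous_on G u'"
    by (rule continuous_on_eq[of _ u]) (use assms in \<open>auto simp: cont_H1_loc_def\<close>)
  ultimately show ?thesis
    using assms(1) eq by (auto simp: cont_H1_loc_def L2_loc_def)
qed

lemma cont_H1_loc_subset:
  assumes "continuous_on G' u" "H1_loc G' u g" "open G" "open G'" "G \<subseteq> G'"
  shows "cont_H1_loc G u g"
proof -
  have "has_weak_gradient G u g"
    unfolding has_weak_gradient_def
  proof (intro conjI allI impI ballI)
    show "locally_integrable G u" "locally_integrable G g"
      using assms(2,5) by (auto simp: H1_loc_def has_weak_gradient_def locally_integrable_def)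
    fix \<phi> and b :: 'a assume \<phi>: "test_function G \<phi>" and b: "b \<in> Basis"
    have "test_function G' \<phi>" using \<phi> assms(5) by (auto simp: test_function_def)
    then have "(LINT x|lebesgue_on G'. u x * frechet_derivative \<phi> (at x) b) = - (LINT x|lebesgue_on G'. (g x \<bullet> b) * \<phi> x)"
      using assms(2) b by (auto simp: H1_loc_def has_weak_gradient_def)
    moreover have z: "\<phi> x = 0" "frechet_derivative \<phi> (at x) b = 0" if "x \<notin> G" for x
      using test_function_derivative_zero[OF \<phi>, of x] \<phi> that by (auto simp: test_function_def)
    have "(LINT x|lebesgue_on A. u x * frechet_derivative \<phi> (at x) b)
        = (LINT x|lebesgue. u x * frechet_derivative \<phi> (at x) b)"
      "(LINT x|lebesgue_on A. (g x \<bullet> b) * \<phi> x) = (LINT x|lebesgue. (g x \<bullet> b) * \<phi> x)"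
      if "open A" "G \<subseteq> A" for A
      by (intro integral_lebesgue_on_extend_zero; use that z in force)+
    ultimately show "(LINT x|lebesgue_on G. u x * frechet_derivative \<phi> (at x) b)
        = - (LINT x|lebesgue_on G. (g x \<bullet> b) * \<phi> x)"
      using assms(3-5) by simp
  qed
  then show ?thesis
    using assms by (auto simp: cont_H1_loc_def H1_loc_def L2_loc_def intro: continuous_on_subset)
qed

text \<open>A test function on \<open>G'\<close> may reach outside \<open>G\<close>, where nothing
  is known about \<open>u\<close>. A cutoff that is 1 near \<open>K\<close> brings it into
  \<open>G\<close> without changing either integral, since \<open>u\<close> and \<open>g\<close>
  vanish off \<open>K\<close>.\<close>

lemma H1_c_extend_zero:
  assumes u: "cont_H1_loc G u g" and K: "compact K" "K \<subseteq> G"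
    and zero: "\<And>x. x \<notin> K \<Longrightarrow> u x = 0" "\<And>x. x \<notin> K \<Longrightarrow> g x = 0"
    and G': "G \<subseteq> G'" "open G'"
  shows "H1_c G' u g"
proof -
  have G: "open G" and cu: "continuous_on G u" and w: "has_weak_gradient G u g" and L: "L2_loc G g"
    using u by (auto simp: cont_H1_loc_def)
  have sK: "K \<in> sets lebesgue" using K(1) by (rule compact_sets_lebesgue)
  have "integrable lebesgue u" "integrable lebesgue g"
    using w K zero by (auto intro!: integrable_extend_zero[OF _ sK] simp: has_weak_gradient_def locally_integrable_def)
  then have li: "locally_integrable G' u" "locally_integrable G' g"
    by (auto simp: locally_integrable_def intro!: integrable_lebesgue_on_subset compact_sets_lebesgue)
  have "has_weak_gradient G' u g"
    unfolding has_weak_gradient_def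
  proof (intro conjI allI impI ballI li)
    fix \<eta> and b :: 'a assume \<eta>: "test_function G' \<eta>" and b: "b \<in> Basis"
    obtain \<zeta> N where \<zeta>: "test_function G \<zeta>" "open N" "K \<subseteq> N" "\<And>y. y \<in> N \<Longrightarrow> \<zeta> y = 1"
      using smooth_cutoff[OF K(1) G K(2)] by metis
    have sm: "smooth \<eta>" "smooth \<zeta>" using \<eta> \<zeta>(1) by (auto simp: test_function_def)
    have "test_function G (\<lambda>x. \<zeta> x * \<eta> x)"
    proof (rule test_functionI)
      show "\<zeta> x * \<eta> x = 0" if "x \<notin> closure {x. \<zeta> x \<noteq> 0}" for x
        using test_function_derivative_zero(1)[OF \<zeta>(1) that] by simp
    qed (use \<zeta>(1) sm in \<open>auto simp: test_function_def intro: smooth_mult\<close>)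
    then have "(LINT x|lebesgue_on G. u x * frechet_derivative (\<lambda>x. \<zeta> x * \<eta> x) (at x) b)
        = - (LINT x|lebesgue_on G. (g x \<bullet> b) * (\<zeta> x * \<eta> x))"
      using w b by (simp add: has_weak_gradient_def)
    moreover have d: "frechet_derivative (\<lambda>x. \<zeta> x * \<eta> x) (at x) = frechet_derivative \<eta> (at x)" if "x \<in> K" for x
    proof -
      have "((\<lambda>x. \<zeta> x * \<eta> x) has_derivative frechet_derivative \<eta> (at x)) (at x)"
        by (rule has_derivative_transform_within_open[OF smooth_has_derivative[OF sm(1)] \<zeta>(2)])
           (use \<zeta>(3,4) that in auto)
      then show ?thesis by (rule frechet_derivative_at[symmetric])
    qed
    have "(LINT x|lebesgue_on G. u x * frechet_derivative (\<lambda>x. \<zeta> x * \<eta> x) (at x) b)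
        = (LINT x|lebesgue. u x * frechet_derivative \<eta> (at x) b)"
    proof (rule integral_lebesgue_on_extend_zero)
      fix x
      show "u x * frechet_derivative (\<lambda>x. \<zeta> x * \<eta> x) (at x) b = u x * frechet_derivative \<eta> (at x) b"
        using d[of x] zero(1)[of x] by (cases "x \<in> K") auto
    qed (use G K zero in auto)
    moreover have "(LINT x|lebesgue_on G. (g x \<bullet> b) * (\<zeta> x * \<eta> x)) = (LINT x|lebesgue. (g x \<bullet> b) * \<eta> x)"
    proof (rule integral_lebesgue_on_extend_zero)
      fix x
      show "(g x \<bullet> b) * (\<zeta> x * \<eta> x) = (g x \<bullet> b) * \<eta> x"
        using \<zeta>(3,4) zero(2)[of x] by (cases "x \<in> K") auto
    qed ((use G K zero in force)+)
    moreover have "(LINT x|lebesgue_on G'. u x * frechet_derivative \<eta> (at x) b)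
        = (LINT x|lebesgue. u x * frechet_derivative \<eta> (at x) b)"
      "(LINT x|lebesgue_on G'. (g x \<bullet> b) * \<eta> x) = (LINT x|lebesgue. (g x \<bullet> b) * \<eta> x)"
      by (rule integral_lebesgue_on_extend_zero; use G' K zero in force)+
    ultimately show "(LINT x|lebesgue_on G'. u x * frechet_derivative \<eta> (at x) b)
        = - (LINT x|lebesgue_on G'. (g x \<bullet> b) * \<eta> x)" by simp
  qed
  moreover have sG': "G' \<in> sets lebesgue" using G'(2) by simp
  have "L2 G' u"
    by (rule L2_extend_zero[OF L2_continuous[OF K(1) continuous_on_subset[OF cu K(2)]] sK zero(1) sG'])
  moreover have "L2 K g" using L K by (simp add: L2_loc_def)
  then have "L2 G' g" by (rule L2_extend_zero[OF _ sK zero(2) sG'])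
  ultimately show ?thesis
    unfolding H1_c_def H1_def using K G'(1) zero(1) by (intro conjI exI[of _ K]) auto
qed

section \<open>Comparison with super-harmonics\<close>

lemma weak_form_extend_zero:
  assumes "open G" "K \<subseteq> G" "\<And>x. x \<notin> K \<Longrightarrow> \<phi> x = 0" "\<And>x. x \<notin> K \<Longrightarrow> D\<phi> x = 0"
  shows "weak_form \<mu> \<Omega> G h Dh \<phi> D\<phi> =
     (LINT x|lebesgue. Dh x \<bullet> D\<phi> x) - (LINT x|lebesgue. \<mu> / (bdist \<Omega> x)\<^sup>2 * h x * \<phi> x)"
proof -
  have z: "\<phi> x = 0" "D\<phi> x = 0" if "x \<notin> G" for x using assms that by auto
  have "(LINT x|lebesgue_on G. Dh x \<bullet> D\<phi> x) = (LINT x|lebesgue. Dh x \<bullet> D\<phi> x)"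
    "(LINT x|lebesgue_on G. \<mu> / (bdist \<Omega> x)\<^sup>2 * h x * \<phi> x) = (LINT x|lebesgue. \<mu> / (bdist \<Omega> x)\<^sup>2 * h x * \<phi> x)"
    using z assms(1) by (auto intro!: integral_lebesgue_on_extend_zero)
  then show ?thesis by (simp add: weak_form_def)
qed

text \<open>Testing against \<open>(x \<bullet> b) * \<zeta>\<close>, with \<open>\<zeta>\<close> a cutoff equal to 1 on \<open>K\<close>, gives \<open>\<integral> u = 0\<close>.\<close>

lemma nonneg_zero_gradient_imp_zero:
  assumes u: "cont_H1_loc G u g" and K: "compact K" "K \<subseteq> G"
    and zero: "\<And>x. x \<notin> K \<Longrightarrow> u x = 0" and nonneg: "\<And>x. u x \<ge> 0"
    and g: "AE x in lebesgue. x \<in> G \<longrightarrow> g x = 0" and x: "x \<in> G"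
  shows "u x = 0"
proof -
  have G: "open G" and cu: "continuous_on G u" and w: "has_weak_gradient G u g"
    using u by (auto simp: cont_H1_loc_def)
  obtain b :: 'a where b: "b \<in> Basis" using nonempty_Basis by blast
  obtain \<zeta> N where \<zeta>: "test_function G \<zeta>" "open N" "K \<subseteq> N" "\<And>y. y \<in> N \<Longrightarrow> \<zeta> y = 1"
    using smooth_cutoff[OF K(1) G K(2)] by metis
  have sm: "smooth \<zeta>" using \<zeta>(1) by (simp add: test_function_def)
  have sb: "smooth (\<lambda>x. x \<bullet> b)" by (simp add: smooth_def Ck_inner_left)
  define \<eta> where "\<eta> x = \<zeta> x * (x \<bullet> b)" for x
  have "test_function G \<eta>"
  proof (rule test_functionI)
    show "\<eta> x = 0" if "x \<notin> closure {x. \<zeta> x \<noteq> 0}" for x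
      using test_function_derivative_zero(1)[OF \<zeta>(1) that] by (simp add: \<eta>_def)
  qed (use \<zeta>(1) smooth_mult[OF sm sb] in \<open>auto simp: test_function_def \<eta>_def[abs_def]\<close>)
  then have "(LINT x|lebesgue_on G. u x * frechet_derivative \<eta> (at x) b) = - (LINT x|lebesgue_on G. (g x \<bullet> b) * \<eta> x)"
    using w b by (simp add: has_weak_gradient_def)
  also have "(LINT x|lebesgue_on G. (g x \<bullet> b) * \<eta> x) = 0"
  proof (rule integral_eq_zero_AE)
    show "AE x in lebesgue_on G. (g x \<bullet> b) * \<eta> x = 0"
      using g G by (auto simp: AE_restrict_space_iff elim: eventually_mono)
  qed
  also have "(LINT x|lebesgue_on G. u x * frechet_derivative \<eta> (at x) b) = (LINT x|lebesgue. u x)"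
  proof (rule integral_lebesgue_on_extend_zero)
    fix x
    show "u x * frechet_derivative \<eta> (at x) b = u x"
    proof (cases "x \<in> K")
      case True
      have "((\<lambda>x. x \<bullet> b) has_derivative (\<lambda>w. w \<bullet> b)) (at x)"
        by (auto intro: derivative_eq_intros)
      then have "(\<eta> has_derivative (\<lambda>w. w \<bullet> b)) (at x)"
        by (rule has_derivative_transform_within_open[OF _ \<zeta>(2)]) (use \<zeta>(3,4) True in \<open>auto simp: \<eta>_def\<close>)
      then have "frechet_derivative \<eta> (at x) = (\<lambda>w. w \<bullet> b)" by (rule frechet_derivative_at[symmetric])
      then show ?thesis using b by simp
    qed (simp add: zero)
  qed (use G K zero in auto)
  finally have "(LINT x|lebesgue. u x) = 0" by simp
  moreover have int: "integrable lebesgue u"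
    using integrable_lebesgue_on_compact[OF K(1) continuous_on_subset[OF cu K(2)]]
    by (rule integrable_extend_zero[OF _ compact_sets_lebesgue[OF K(1)]]) (rule zero)
  ultimately have "AE x in lebesgue. u x = 0"
    using integral_nonneg_eq_0_iff_AE[OF int] nonneg by simp
  then show ?thesis by (intro AE_zero_on_open[OF G cu _ x]) (auto elim: eventually_mono)
qed

text \<open>Each of the three functions brings its own open set; the test functions vanish off
  \<open>K\<close> and are thus admissible on all three. On \<open>K\<close> the distance is
  nonzero, so the potential is continuous there and its integrals can be split.\<close>

lemma subharmonic_le_superharmonic:
  fixes h H H' :: "'a::euclidean_space \<Rightarrow> real"
  assumes G: "open G" "open Gh" "open GH" "open GH'" "G \<subseteq> Gh" "G \<subseteq> GH" "G \<subseteq> GH'"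
    and sub: "subharmonic \<mu> \<Omega> Gh h"
    and super: "superharmonic \<mu> \<Omega> GH H" "superharmonic \<mu> \<Omega> GH' H'"
    and pos: "\<And>x. x \<in> G \<Longrightarrow> H x > 0" "\<And>x. x \<in> G \<Longrightarrow> H' x > 0" "C > 0" "\<epsilon> > 0"
    and K: "compact K" "K \<subseteq> G" "\<And>x. x \<in> K \<Longrightarrow> bdist \<Omega> x \<noteq> 0"
    and le: "\<And>x. x \<in> G - K \<Longrightarrow> h x \<le> C * H x + \<epsilon> * H' x"
    and x: "x \<in> G"
  shows "h x \<le> C * H x + \<epsilon> * H' x"
proof -
  obtain Dh where Dh: "H1_loc Gh h Dh" "continuous_on Gh h"
    "\<And>\<phi> D\<phi>. H1_c Gh \<phi> D\<phi> \<Longrightarrow> (AE x in lebesgue_on Gh. 0 \<le> \<phi> x) \<Longrightarrow> weak_form \<mu> \<Omega> Gh h Dh \<phi> D\<phi> \<le> 0"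
    using sub unfolding subharmonic_def by blast
  obtain DH where DH: "H1_loc GH H DH" "continuous_on GH H"
    "\<And>\<phi> D\<phi>. H1_c GH \<phi> D\<phi> \<Longrightarrow> (AE x in lebesgue_on GH. 0 \<le> \<phi> x) \<Longrightarrow> weak_form \<mu> \<Omega> GH H DH \<phi> D\<phi> \<ge> 0"
    using super(1) unfolding superharmonic_def by blast
  obtain DH' where DH': "H1_loc GH' H' DH'" "continuous_on GH' H'"
    "\<And>\<phi> D\<phi>. H1_c GH' \<phi> D\<phi> \<Longrightarrow> (AE x in lebesgue_on GH'. 0 \<le> \<phi> x) \<Longrightarrow> weak_form \<mu> \<Omega> GH' H' DH' \<phi> D\<phi> \<ge> 0"
    using super(2) unfolding superharmonic_def by blast
  have ch: "cont_H1_loc G h Dh" "cont_H1_loc G H DH" "cont_H1_loc G H' DH'"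
    by (rule cont_H1_loc_subset[OF Dh(2,1) G(1,2,5)] cont_H1_loc_subset[OF DH(2,1) G(1,3,6)]
        cont_H1_loc_subset[OF DH'(2,1) G(1,4,7)])+
  define V where "V x = C * H x + \<epsilon> * H' x" for x
  define DV where "DV x = C *\<^sub>R DH x + \<epsilon> *\<^sub>R DH' x" for x
  have V: "cont_H1_loc G V DV"
    unfolding V_def[abs_def] DV_def[abs_def] by (intro cont_H1_loc_add cont_H1_loc_scale ch)
  have Vpos: "V x > 0" if "x \<in> G" for x
    using pos that by (simp add: V_def add_pos_pos)
  define t where "t x = h x * inverse (V x)" for x
  define Dt where "Dt x = h x *\<^sub>R ((- inverse ((V x)\<^sup>2)) *\<^sub>R DV x) + inverse (V x) *\<^sub>R Dh x" for x
  have t: "cont_H1_loc G t Dt"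
    unfolding t_def[abs_def] Dt_def[abs_def]
    by (intro cont_H1_loc_mult ch cont_H1_loc_inverse[OF V Vpos])
  \<comment> \<open>\<open>flat 0\<close> has derivative \<open>flat 2\<close>, which is positive
    exactly where its argument is: it vanishes up to \<open>t = 1\<close> and increases strictly
    afterwards.\<close>
  define g where "g x = flat 0 (t x - 1)" for x
  define Dg where "Dg x = flat 2 (t x - 1) *\<^sub>R Dt x" for x
  have g: "cont_H1_loc G g Dg"
    unfolding g_def[abs_def] Dg_def[abs_def]
  proof (rule cont_H1_loc_chain[OF t open_UNIV, of "\<lambda>s. flat 0 (s - 1)" "\<lambda>s. flat 2 (s - 1)"])
    show "((\<lambda>s. flat 0 (s - 1)) has_real_derivative flat 2 (s - 1)) (at s)" for s
      using DERIV_shift[of "flat 0" "flat 2 (s - 1)" s "-1"] flat_has_derivative[of 0 "s - 1"]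
      by (simp add: numeral_2_eq_2)
    have "continuous_on UNIV (flat 2)"
      using flat_has_derivative by (meson DERIV_isCont continuous_at_imp_continuous_on)
    then show "continuous_on UNIV (\<lambda>s. flat 2 (s - 1))"
      by (rule continuous_on_compose2) (auto intro: continuous_intros)
  qed auto
  have g0: "g x = 0" "Dg x = 0" if "x \<in> G" "x \<notin> K" for x
  proof -
    have "t x \<le> 1" using le[of x] Vpos[of x] that by (simp add: t_def V_def field_simps)
    then show "g x = 0" "Dg x = 0" by (simp_all add: g_def Dg_def flat_zero)
  qed
  have gnn: "g x \<ge> 0" for x by (simp add: g_def flat_nonneg)
  \<comment> \<open>On \<open>G\<close> the case distinction changes nothing, by \<open>g0\<close>;
    off \<open>G\<close> it enforces the vanishing needed for extension by zero.\<close>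
  define \<phi> where "\<phi> x = (if x \<in> K then V x * g x else 0)" for x
  define D\<phi> where "D\<phi> x = (if x \<in> K then V x *\<^sub>R Dg x + g x *\<^sub>R DV x else 0)" for x
  define \<psi> where "\<psi> x = (if x \<in> K then h x * g x else 0)" for x
  define D\<psi> where "D\<psi> x = (if x \<in> K then h x *\<^sub>R Dg x + g x *\<^sub>R Dh x else 0)" for x
  define gK where "gK x = (if x \<in> K then g x else 0)" for x
  define DgK where "DgK x = (if x \<in> K then Dg x else 0)" for x
  have \<phi>: "cont_H1_loc G \<phi> D\<phi>"
    by (rule cont_H1_loc_cong[OF cont_H1_loc_mult[OF V g]]) (auto simp: \<phi>_def D\<phi>_def g0)
  have \<psi>: "cont_H1_loc G \<psi> D\<psi>"
    by (rule cont_H1_loc_cong[OF cont_H1_loc_mult[OF ch(1) g]]) (auto simp: \<psi>_def D\<psi>_def g0)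
  have gK: "cont_H1_loc G gK DgK"
    by (rule cont_H1_loc_cong[OF g]) (auto simp: gK_def DgK_def g0)
  have \<phi>0: "\<phi> x = 0" "D\<phi> x = 0" and \<psi>0: "\<psi> x = 0" "D\<psi> x = 0" if "x \<notin> K" for x
    using that by (simp_all add: \<phi>_def D\<phi>_def \<psi>_def D\<psi>_def)
  have \<phi>nn: "\<phi> x \<ge> 0" for x
    using Vpos[of x] K(2) gnn[of x] by (auto simp: \<phi>_def intro!: mult_nonneg_nonneg)
  \<comment> \<open>\<open>h\<close> has no sign of its own, but where \<open>g x\<close> is nonzero
    one has \<open>t x > 1\<close>, hence \<open>h x > V x > 0\<close>.\<close>
  have \<psi>nn: "\<psi> x \<ge> 0" for x
  proof (cases "x \<in> K \<and> g x \<noteq> 0")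
    case True
    then have "t x > 1" using flat_zero[of "t x - 1" 0] by (force simp: g_def)
    moreover have "V x > 0" using Vpos[of x] True K(2) by auto
    ultimately have "h x > V x" by (simp add: t_def field_simps)
    then have "h x > 0" using \<open>V x > 0\<close> by simp
    then show ?thesis using gnn[of x] by (simp add: \<psi>_def)
  qed (auto simp: \<psi>_def)
  define pot where "pot x = \<mu> / (bdist \<Omega> x)\<^sup>2 * h x * \<phi> x" for x
  have pots: "\<mu> / (bdist \<Omega> x)\<^sup>2 * V x * \<psi> x = pot x" for x
    by (simp add: pot_def \<phi>_def \<psi>_def)
  define q where "q u x = \<mu> / (bdist \<Omega> x)\<^sup>2 * u x * \<psi> x" for u :: "'a \<Rightarrow> real" and x
  have cK: "continuous_on K H" "continuous_on K H'" "continuous_on K \<psi>"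
    using ch \<psi> K(2) by (auto simp: cont_H1_loc_def intro: continuous_on_subset)
  have bc: "continuous_on K (bdist \<Omega>)"
    unfolding bdist_def[abs_def] by (intro continuous_intros)
  have iq: "integrable lebesgue (q u)" if "continuous_on K u" for u
  proof (rule integrable_compact_support[OF K(1)])
    show "continuous_on K (q u)"
      unfolding q_def[abs_def] using K(3) by (intro continuous_intros bc that cK) auto
  qed (simp add: q_def \<psi>0)
  have iD: "integrable lebesgue (\<lambda>x. a x \<bullet> k x)"
    if "L2_loc G a" "L2_loc G k" "\<And>x. x \<notin> K \<Longrightarrow> k x = 0" for a k :: "'a \<Rightarrow> 'a"
    using that K by (intro integrable_extend_zero[OF L2_imp_integrable_inner compact_sets_lebesgue[OF K(1)]])
      (auto simp: L2_loc_def)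
  have L2: "L2_loc G Dh" "L2_loc G DH" "L2_loc G DH'" "L2_loc G D\<phi>" "L2_loc G D\<psi>" "L2_loc G DV"
    using ch \<phi> \<psi> V by (auto simp: cont_H1_loc_def)
  have "(LINT x|lebesgue. Dh x \<bullet> D\<phi> x) - (LINT x|lebesgue. pot x) \<le> 0"
    using Dh(3)[OF H1_c_extend_zero[OF \<phi> K(1,2) \<phi>0 G(5,2)]] \<phi>nn
      weak_form_extend_zero[OF G(2) order_trans[OF K(2) G(5)] \<phi>0]
    by (simp add: pot_def)
  moreover have superH: "(LINT x|lebesgue. DH x \<bullet> D\<psi> x) - (LINT x|lebesgue. q H x) \<ge> 0"
    using DH(3)[OF H1_c_extend_zero[OF \<psi> K(1,2) \<psi>0 G(6,3)]] \<psi>nn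
      weak_form_extend_zero[OF G(3) order_trans[OF K(2) G(6)] \<psi>0]
    by (simp add: q_def)
  moreover have superH': "(LINT x|lebesgue. DH' x \<bullet> D\<psi> x) - (LINT x|lebesgue. q H' x) \<ge> 0"
    using DH'(3)[OF H1_c_extend_zero[OF \<psi> K(1,2) \<psi>0 G(7,4)]] \<psi>nn
      weak_form_extend_zero[OF G(4) order_trans[OF K(2) G(7)] \<psi>0]
    by (simp add: q_def)
  moreover have "(LINT x|lebesgue. DV x \<bullet> D\<psi> x)
      = C * (LINT x|lebesgue. DH x \<bullet> D\<psi> x) + \<epsilon> * (LINT x|lebesgue. DH' x \<bullet> D\<psi> x)"
    using iD[OF L2(2,5) \<psi>0(2)] iD[OF L2(3,5) \<psi>0(2)] by (simp add: DV_def inner_add_left)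
  \<comment> \<open>The inequality is known for \<open>H\<close> and \<open>H'\<close> separately,
    so the common potential term is split into their shares.\<close>
  moreover have "(LINT x|lebesgue. pot x) = C * (LINT x|lebesgue. q H x) + \<epsilon> * (LINT x|lebesgue. q H' x)"
  proof -
    have "pot x = C * q H x + \<epsilon> * q H' x" for x
      unfolding pots[symmetric] by (simp add: q_def V_def algebra_simps add_divide_distrib)
    then show ?thesis using iq cK by simp
  qed
  moreover from superH have "C * (LINT x|lebesgue. q H x) \<le> C * (LINT x|lebesgue. DH x \<bullet> D\<psi> x)"
    using pos(3) by (intro mult_left_mono) auto
  moreover from superH' have "\<epsilon> * (LINT x|lebesgue. q H' x) \<le> \<epsilon> * (LINT x|lebesgue. DH' x \<bullet> D\<psi> x)"
    using pos(4) by (intro mult_left_mono) auto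
  ultimately have "(LINT x|lebesgue. Dh x \<bullet> D\<phi> x) \<le> (LINT x|lebesgue. DV x \<bullet> D\<psi> x)"
    by linarith
  moreover define E where "E x = Dh x \<bullet> D\<phi> x - DV x \<bullet> D\<psi> x" for x
  have iE: "integrable lebesgue E"
    unfolding E_def[abs_def] using iD[OF L2(1,4) \<phi>0(2)] iD[OF L2(6,5) \<psi>0(2)] by simp
  have "(LINT x|lebesgue. E x) = (LINT x|lebesgue. Dh x \<bullet> D\<phi> x) - (LINT x|lebesgue. DV x \<bullet> D\<psi> x)"
    unfolding E_def using iD[OF L2(1,4) \<phi>0(2)] iD[OF L2(6,5) \<psi>0(2)] by simp
  ultimately have "(LINT x|lebesgue. E x) \<le> 0" by simp
  \<comment> \<open>The terms \<open>g x * (Dh x \<bullet> DV x)\<close> cancel. What is left pairs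
    \<open>V x *\<^sub>R Dh x - h x *\<^sub>R DV x\<close>, which is
    \<open>(V x)\<^sup>2 *\<^sub>R Dt x\<close>, with \<open>Dg x\<close>.\<close>
  have E: "E x = (V x)\<^sup>2 * (flat 2 (t x - 1) * (Dt x \<bullet> Dt x))" if x: "x \<in> K" for x
  proof -
    have "V x \<noteq> 0" using Vpos[of x] x K(2) by auto
    then have "V x *\<^sub>R Dh x - h x *\<^sub>R DV x = (V x)\<^sup>2 *\<^sub>R Dt x"
      by (simp add: Dt_def algebra_simps power2_eq_square)
    then have *: "V x * (Dh x \<bullet> w) - h x * (DV x \<bullet> w) = (V x)\<^sup>2 * (Dt x \<bullet> w)" for w
      by (metis inner_diff_left inner_scaleR_left)
    have "E x = V x * (Dh x \<bullet> Dg x) - h x * (DV x \<bullet> Dg x)"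
      using x by (simp add: E_def D\<phi>_def D\<psi>_def inner_add_right inner_commute)
    then show ?thesis using *[of "Dg x"] by (simp add: Dg_def)
  qed
  have Enn: "E x \<ge> 0" for x
    using E[of x] flat_nonneg[of 2 "t x - 1"] by (cases "x \<in> K") (auto simp: E_def \<phi>0 \<psi>0)
  have "(LINT x|lebesgue. E x) = 0"
    using \<open>(LINT x|lebesgue. E x) \<le> 0\<close> Bochner_Integration.integral_nonneg[of lebesgue E, OF Enn]
    by linarith
  then have "AE x in lebesgue. E x = 0"
    using integral_nonneg_eq_0_iff_AE[OF iE] Enn by simp
  \<comment> \<open>On \<open>K\<close>, \<open>V\<close> is nonzero, so \<open>E x = 0\<close>
    annihilates either \<open>flat 2 (t x - 1)\<close> or \<open>Dt x\<close>; each makes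
    \<open>Dg x\<close> vanish.\<close>
  then have "AE x in lebesgue. x \<in> G \<longrightarrow> DgK x = 0"
  proof (rule eventually_mono, intro impI)
    fix x assume "E x = 0"
    show "DgK x = 0"
    proof (cases "x \<in> K")
      case True
      then have "V x \<noteq> 0" using Vpos[of x] K(2) by auto
      then show ?thesis using E[OF True] \<open>E x = 0\<close> by (auto simp: DgK_def Dg_def)
    qed (simp add: DgK_def)
  qed
  from nonneg_zero_gradient_imp_zero[OF gK K(1,2) _ _ this x]
  have "gK x = 0" using gnn by (simp add: gK_def)
  then have "g x = 0" using g0[OF x] by (auto simp: gK_def split: if_splits)
  then have "t x \<le> 1" using flat_pos[of "t x - 1" 0] by (force simp: g_def)
  then show ?thesis using Vpos[OF x] by (simp add: t_def V_def field_simps)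
qed

section \<open>Strips and annuli along the boundary\<close>

lemma strip_open: "open \<Omega> \<Longrightarrow> open (strip \<Omega> \<rho>)"
proof -
  assume "open \<Omega>"
  moreover have "open {x. bdist \<Omega> x < \<rho>}"
    unfolding bdist_def by (intro open_Collect_less continuous_intros)
  moreover have "strip \<Omega> \<rho> = \<Omega> \<inter> {x. bdist \<Omega> x < \<rho>}" by (auto simp: strip_def)
  ultimately show ?thesis by auto
qed

text \<open>A point of the closure missing from \<open>\<Omega>\<close> lies on the frontier, where
  the distance is \<open>0 < a\<close>. Hence the annulus is closed in the whole space.\<close>

lemma compact_annulus:
  fixes \<Omega> :: "'a::euclidean_space set"
  assumes "open \<Omega>" "bounded \<Omega>" "a > 0"
  shows "compact {x \<in> \<Omega>. a \<le> bdist \<Omega> x \<and> bdist \<Omega> x \<le> b}"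
proof -
  have "x \<in> \<Omega>" if "x \<in> closure \<Omega>" "a \<le> bdist \<Omega> x" for x
  proof (rule ccontr)
    assume "x \<notin> \<Omega>"
    then have "x \<in> frontier \<Omega>" using that assms(1) by (simp add: frontier_def interior_open)
    then show False using that(2) assms(3) by (simp add: bdist_def)
  qed
  then have "{x \<in> \<Omega>. a \<le> bdist \<Omega> x \<and> bdist \<Omega> x \<le> b}
      = closure \<Omega> \<inter> ({x. a \<le> bdist \<Omega> x} \<inter> {x. bdist \<Omega> x \<le> b})"
    using closure_subset by blast
  moreover have "closed {x. a \<le> bdist \<Omega> x}" "closed {x. bdist \<Omega> x \<le> b}"
    unfolding bdist_def by (intro closed_Collect_le continuous_intros)+
  ultimately show ?thesis
    using assms(2) by (simp add: compact_Int_closed closed_Int compact_closure)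
qed

theorem theorem2p6:
  fixes \<Omega> :: "(real ^ 'n) set" and \<mu> :: real and h :: "real ^ 'n \<Rightarrow> real"
  assumes "CARD('n) \<ge> 2"
    and "bounded_smooth_domain \<Omega>"
    and "\<mu> \<le> 1 / 4"
    and "local_subharmonic \<mu> \<Omega> h"
  shows "(\<forall>H. pos_local_superharmonic \<mu> \<Omega> H \<longrightarrow>
            Limsup (to_boundary \<Omega>) (\<lambda>x. ereal (h x / H x)) > 0)
       \<or> (\<forall>H. pos_local_superharmonic \<mu> \<Omega> H \<longrightarrow>
            Limsup (to_boundary \<Omega>) (\<lambda>x. ereal (h x / H x)) < \<infinity>)"
proof (cases "\<forall>H. pos_local_superharmonic \<mu> \<Omega> H \<longrightarrow>
            Limsup (to_boundary \<Omega>) (\<lambda>x. ereal (h x / H x)) > 0")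
  case False
  have \<Omega>: "open \<Omega>" "bounded \<Omega>" using assms(2) by (auto simp: bounded_smooth_domain_def)
  obtain \<rho>h where \<rho>h: "\<rho>h > 0" "subharmonic \<mu> \<Omega> (strip \<Omega> \<rho>h) h"
    using assms(4) by (auto simp: local_subharmonic_def)
  obtain H' where H': "pos_local_superharmonic \<mu> \<Omega> H'"
    "Limsup (to_boundary \<Omega>) (\<lambda>x. ereal (h x / H' x)) \<le> 0"
    using False by (auto simp: not_less)
  obtain \<rho>' where \<rho>': "\<rho>' > 0" "superharmonic \<mu> \<Omega> (strip \<Omega> \<rho>') H'" "\<And>x. x \<in> strip \<Omega> \<rho>' \<Longrightarrow> H' x > 0"
    using H'(1) by (auto simp: pos_local_superharmonic_def)
  have "Limsup (to_boundary \<Omega>) (\<lambda>x. ereal (h x / H x)) < \<infinity>" if H: "pos_local_superharmonic \<mu> \<Omega> H" for H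
  proof -
    obtain \<rho>H where \<rho>H: "\<rho>H > 0" "superharmonic \<mu> \<Omega> (strip \<Omega> \<rho>H) H" "\<And>x. x \<in> strip \<Omega> \<rho>H \<Longrightarrow> H x > 0"
      using H by (auto simp: pos_local_superharmonic_def)
    define r where "r = min \<rho>h (min \<rho>' \<rho>H)"
    have r: "r > 0" "r \<le> \<rho>h" "r \<le> \<rho>'" "r \<le> \<rho>H" using \<rho>h \<rho>' \<rho>H by (auto simp: r_def)
    define G where "G = strip \<Omega> (r / 2)"
    have strip_mono: "strip \<Omega> a \<subseteq> strip \<Omega> b" if "a \<le> b" for a b
      using that by (auto simp: strip_def)
    have G: "G \<subseteq> strip \<Omega> \<rho>h" "G \<subseteq> strip \<Omega> \<rho>H" "G \<subseteq> strip \<Omega> \<rho>'"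
      unfolding G_def using r by (intro strip_mono; simp)+
    \<comment> \<open>The outer bound \<open>r / 2\<close> keeps this closed annulus inside the
      strips of \<open>h\<close> and \<open>H\<close>, and the inner bound \<open>r / 4\<close>
      leaves room for the compact set on which the comparison takes place.\<close>
    define A where "A = {x \<in> \<Omega>. r / 4 \<le> bdist \<Omega> x \<and> bdist \<Omega> x \<le> r / 2}"
    have A: "compact A" unfolding A_def using r by (intro compact_annulus \<Omega>) auto
    have "A \<subseteq> strip \<Omega> \<rho>h" "A \<subseteq> strip \<Omega> \<rho>H" using r by (auto simp: A_def strip_def)
    moreover from this have "H x \<noteq> 0" if "x \<in> A" for x using \<rho>H(3)[of x] that by auto
    ultimately have "continuous_on A (\<lambda>x. h x / H x)"
      using \<rho>h(2) \<rho>H(2) unfolding subharmonic_def superharmonic_def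
      by (intro continuous_on_divide) (auto intro: continuous_on_subset)
    from bounded_on_compact[OF A this] obtain B where B: "B \<ge> 0" "\<And>x. x \<in> A \<Longrightarrow> \<bar>h x / H x\<bar> \<le> B"
      by blast
    \<comment> \<open>\<open>B\<close> may be 0, whereas the comparison asks for a strictly positive
      coefficient.\<close>
    define C where "C = B + 1"
    have le: "h x \<le> C * H x + \<epsilon> * H' x" if x: "x \<in> G" and \<epsilon>: "\<epsilon> > 0" for x \<epsilon>
    proof -
      have "Limsup (to_boundary \<Omega>) (\<lambda>x. ereal (h x / H' x)) < ereal \<epsilon>"
        using H'(2) \<epsilon> by (simp add: le_less_trans)
      then have "eventually (\<lambda>x. ereal (h x / H' x) < ereal \<epsilon>) (to_boundary \<Omega>)"
        by (rule Limsup_lessD)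
      then obtain s where s: "s > 0" "\<And>x. x \<in> \<Omega> \<Longrightarrow> bdist \<Omega> x < s \<Longrightarrow> h x / H' x < \<epsilon>"
        by (auto simp: eventually_to_boundary)
      \<comment> \<open>Closer than \<open>s\<close> to the boundary \<open>\<epsilon> * H'\<close>
        dominates \<open>h\<close>, and beyond \<open>r / 4\<close> the bound on \<open>A\<close>
        applies, so \<open>h\<close> can exceed the comparison function only here. \<open>K\<close>
        depends on \<open>\<epsilon>\<close> through \<open>s\<close>; \<open>A\<close> and
        \<open>C\<close> do not, which lets \<open>\<epsilon>\<close> tend to 0 with
        \<open>C\<close> fixed.\<close>
      define K where "K = {x \<in> \<Omega>. s \<le> bdist \<Omega> x \<and> bdist \<Omega> x \<le> r / 4}"
      have K: "compact K" "K \<subseteq> G" "\<And>x. x \<in> K \<Longrightarrow> bdist \<Omega> x \<noteq> 0"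
        unfolding K_def using s(1) r(1) compact_annulus[OF \<Omega> s(1), of "r / 4"]
        by (auto simp: G_def strip_def)
      have "open G" unfolding G_def by (rule strip_open[OF \<Omega>(1)])
      then show ?thesis
      proof (rule subharmonic_le_superharmonic[OF _ strip_open strip_open strip_open G \<rho>h(2) \<rho>H(2) \<rho>'(2)])
        fix y assume y: "y \<in> G - K"
        then have pos: "H y > 0" "H' y > 0" using G \<rho>H(3) \<rho>'(3) by auto
        consider "bdist \<Omega> y < s" | "y \<in> A"
          using y by (auto simp: G_def K_def A_def strip_def)
        then show "h y \<le> C * H y + \<epsilon> * H' y"
        proof cases
          case 1
          then have "h y < \<epsilon> * H' y" using s(2)[of y] y pos by (auto simp: G_def strip_def field_simps)
          moreover have "C * H y \<ge> 0" using B(1) pos by (simp add: C_def)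
          ultimately show ?thesis by simp
        next
          case 2
          then have "h y / H y \<le> C" using abs_le_D1[OF B(2)[OF 2]] by (simp add: C_def)
          then have "h y \<le> C * H y" using pos by (simp add: field_simps)
          moreover have "\<epsilon> * H' y \<ge> 0" using \<epsilon> pos by simp
          ultimately show ?thesis by simp
        qed
      qed (use \<Omega> G \<rho>H(3) \<rho>'(3) B(1) \<epsilon> K x in \<open>auto simp: C_def\<close>)
    qed
    have "h x / H x \<le> C" if x: "x \<in> G" for x
    proof -
      have pos: "H x > 0" "H' x > 0" using x G \<rho>H(3) \<rho>'(3) by auto
      have "h x \<le> C * H x"
      proof (rule field_le_epsilon)
        fix e :: real assume "e > 0"
        \<comment> \<open>At a fixed \<open>x\<close>, taking \<open>\<epsilon> = e / H' x\<close>
          makes the second summand equal to \<open>e\<close>.\<close>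
        then show "h x \<le> C * H x + e" using le[OF x, of "e / H' x"] pos by simp
      qed
      then show ?thesis using pos by (simp add: field_simps)
    qed
    then have "eventually (\<lambda>x. ereal (h x / H x) \<le> ereal C) (to_boundary \<Omega>)"
      unfolding eventually_to_boundary using r(1) by (intro exI[of _ "r / 2"]) (auto simp: G_def strip_def)
    then have "Limsup (to_boundary \<Omega>) (\<lambda>x. ereal (h x / H x)) \<le> ereal C"
      by (rule Limsup_bounded)
    then show ?thesis by (rule order.strict_trans1) simp
  qed
  then show ?thesis by blast
qed blast

end
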